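(* Let $k$ be a perfect field of prime characteristic $p$, $R=k[x_1,\ldots,x_d]$ a polynomial ring, and $I\subseteq R$ a square-free monomial ideal. Then the symbolic Rees algebra $\mathcal R^s(I)$ and the symbolic associated graded algebra $\operatorname{gr}^s_I(R)$ are $F$-pure.
   Context: For $n\in\mathbb Z_{>0}$, the $n$-th symbolic power of $I$ is $I^{(n)}=\bigcap_{\mathfrak p\in \operatorname{Min}(R/I)} (I^nR_{\mathfrak p}\cap R)$, where $\operatorname{Min}(R/I)$ is the set of minimal primes of $I$; $I^{(0)}=R$. The symbolic Rees algebra is $\mathcal R^s(I)=\bigoplus_{n\geq 0}I^{(n)}t^n\subseteq R[t]$ and the symbolic associated graded algebra is $\operatorname{gr}^s_I(R)=\bigoplus_{n\geq 0}I^{(n)}/I^{(n+1)}$. A ring $S$ of prime characteristic $p$ is $F$-pure if the Frobenius map $F:S\to S$, $s\mapsto s^p$, is a pure homomorphism, i.e. it remains injective after tensoring over $S$ with any $S$-module. *)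

theory Defs
  imports
    "HOL-Algebra.Algebra"
    "HOL-Algebra.Algebraic_Closure_Type"
    "HOL-Library.Poly_Mapping"
begin

section \<open>Localization and symbolic powers\<close>

definition fraction_rel :: "('a, 'b) ring_scheme \<Rightarrow> 'a set \<Rightarrow> (('a \<times> 'a) \<times> ('a \<times> 'a)) set"
  where "fraction_rel R S =
    {((a, s), (b, t)). a \<in> carrier R \<and> s \<in> S \<and> b \<in> carrier R \<and> t \<in> S \<and>
       (\<exists>u\<in>S. u \<otimes>\<^bsub>R\<^esub> (a \<otimes>\<^bsub>R\<^esub> t \<ominus>\<^bsub>R\<^esub> b \<otimes>\<^bsub>R\<^esub> s) = \<zero>\<^bsub>R\<^esub>)}"

definition fraction :: "('a, 'b) ring_scheme \<Rightarrow> 'a set \<Rightarrow> 'a \<Rightarrow> 'a \<Rightarrow> ('a \<times> 'a) set"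
  where "fraction R S a s = fraction_rel R S `` {(a, s)}"

text \<open>The ring of fractions with denominators in the multiplicative set \<open>S\<close>. As in
  \<^const>\<open>rcoset_mult\<close>, the operations on classes are unions over all representatives;
  every term of the union is the same class.\<close>

definition localization :: "('a, 'b) ring_scheme \<Rightarrow> 'a set \<Rightarrow> ('a \<times> 'a) set ring"
  where "localization R S =
    \<lparr>carrier = (carrier R \<times> S) // fraction_rel R S,
     monoid.mult = (\<lambda>U V. \<Union>x\<in>U. \<Union>y\<in>V. fraction R S (fst x \<otimes>\<^bsub>R\<^esub> fst y) (snd x \<otimes>\<^bsub>R\<^esub> snd y)),
     one = fraction R S \<one>\<^bsub>R\<^esub> \<one>\<^bsub>R\<^esub>,
     ring.zero = fraction R S \<zero>\<^bsub>R\<^esub> \<one>\<^bsub>R\<^esub>,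
     add = (\<lambda>U V. \<Union>x\<in>U. \<Union>y\<in>V.
              fraction R S (fst x \<otimes>\<^bsub>R\<^esub> snd y \<oplus>\<^bsub>R\<^esub> fst y \<otimes>\<^bsub>R\<^esub> snd x) (snd x \<otimes>\<^bsub>R\<^esub> snd y))\<rparr>"

definition localization_at :: "('a, 'b) ring_scheme \<Rightarrow> 'a set \<Rightarrow> ('a \<times> 'a) set ring"
  where "localization_at R P = localization R (carrier R - P)"

definition to_localization_at :: "('a, 'b) ring_scheme \<Rightarrow> 'a set \<Rightarrow> 'a \<Rightarrow> ('a \<times> 'a) set"
  where "to_localization_at R P r = fraction R (carrier R - P) r \<one>\<^bsub>R\<^esub>"

definition minimal_primes :: "('a, 'b) ring_scheme \<Rightarrow> 'a set \<Rightarrow> 'a set set"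
  where "minimal_primes R I =
    {P. primeideal P R \<and> I \<subseteq> P \<and> (\<forall>Q. primeideal Q R \<and> I \<subseteq> Q \<and> Q \<subseteq> P \<longrightarrow> Q = P)}"

definition localize_contract :: "('a, 'b) ring_scheme \<Rightarrow> 'a set \<Rightarrow> 'a set \<Rightarrow> 'a set"
  where "localize_contract R P J =
    {r \<in> carrier R. to_localization_at R P r
       \<in> genideal (localization_at R P) (to_localization_at R P ` J)}"

text \<open>The intersection is taken inside \<open>R\<close>, so the unit ideal, which has no minimal primes,
  has all its symbolic powers equal to \<open>R\<close>.\<close>

definition symbolic_power :: "('a, 'b) ring_scheme \<Rightarrow> 'a set \<Rightarrow> nat \<Rightarrow> 'a set"
  where "symbolic_power R I n =
    (if n = 0 then carrier R
     else carrier R \<inter>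
       (\<Inter>P\<in>minimal_primes R I. localize_contract R P (I [^]\<^bsub>ideals_set R\<^esub> n)))"


section \<open>Symbolic Rees algebra and symbolic associated graded algebra\<close>

definition symbolic_Rees_algebra :: "('a, 'b) ring_scheme \<Rightarrow> 'a set \<Rightarrow> ('a, nat \<Rightarrow> 'a) up_ring"
  where "symbolic_Rees_algebra R I =
    (UP R)\<lparr>carrier := {f \<in> carrier (UP R). \<forall>n. up_ring.coeff (UP R) f n \<in> symbolic_power R I n}\<rparr>"

text \<open>An element of the direct sum is a finitely supported family whose \<open>n\<close>-th component is a
  coset \<open>a + I\<^sup>(\<^sup>n\<^sup>+\<^sup>1\<^sup>)\<close> with \<open>a \<in> I\<^sup>(\<^sup>n\<^sup>)\<close>; the zero of the \<open>n\<close>-th summand is the coset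
  \<open>I\<^sup>(\<^sup>n\<^sup>+\<^sup>1\<^sup>)\<close> itself. Each summand is a subgroup of \<open>R / I\<^sup>(\<^sup>n\<^sup>+\<^sup>1\<^sup>)\<close>, where the sums are formed.
  The product of \<open>a + I\<^sup>(\<^sup>i\<^sup>+\<^sup>1\<^sup>)\<close> and \<open>b + I\<^sup>(\<^sup>j\<^sup>+\<^sup>1\<^sup>)\<close> is \<open>a b + I\<^sup>(\<^sup>i\<^sup>+\<^sup>j\<^sup>+\<^sup>1\<^sup>)\<close>.\<close>

definition symbolic_gr :: "('a, 'b) ring_scheme \<Rightarrow> 'a set \<Rightarrow> (nat \<Rightarrow> 'a set) ring"
  where "symbolic_gr R I =
    \<lparr>carrier = {f. (\<forall>n. f n \<in> (\<lambda>a. symbolic_power R I (Suc n) +>\<^bsub>R\<^esub> a) ` symbolic_power R I n) \<and>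
                   finite {n. f n \<noteq> symbolic_power R I (Suc n)}},
     monoid.mult = (\<lambda>f g n. finsum (R Quot symbolic_power R I (Suc n))
               (\<lambda>i. rcoset_mult R (symbolic_power R I (Suc n)) (f i) (g (n - i))) {..n}),
     one = (\<lambda>n. if n = 0 then symbolic_power R I 1 +>\<^bsub>R\<^esub> \<one>\<^bsub>R\<^esub> else symbolic_power R I (Suc n)),
     ring.zero = (\<lambda>n. symbolic_power R I (Suc n)),
     add = (\<lambda>f g n. f n \<oplus>\<^bsub>R Quot symbolic_power R I (Suc n)\<^esub> g n)\<rparr>"


section \<open>Tensor products and purity\<close>

definition tensor_relations ::
    "('a, 'b) ring_scheme \<Rightarrow> ('a, 'n, 'c) module_scheme \<Rightarrow> ('a, 'm, 'd) module_scheme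
      \<Rightarrow> ('n \<times> 'm \<Rightarrow>\<^sub>0 int) set"
  where "tensor_relations A N M =
    {frag_of (x \<oplus>\<^bsub>N\<^esub> y, m) - frag_of (x, m) - frag_of (y, m) | x y m.
        x \<in> carrier N \<and> y \<in> carrier N \<and> m \<in> carrier M} \<union>
    {frag_of (x, m \<oplus>\<^bsub>M\<^esub> m') - frag_of (x, m) - frag_of (x, m') | x m m'.
        x \<in> carrier N \<and> m \<in> carrier M \<and> m' \<in> carrier M} \<union>
    {frag_of (a \<odot>\<^bsub>N\<^esub> x, m) - frag_of (x, a \<odot>\<^bsub>M\<^esub> m) | a x m.
        a \<in> carrier A \<and> x \<in> carrier N \<and> m \<in> carrier M}"

definition tensor_subgroup ::
    "('a, 'b) ring_scheme \<Rightarrow> ('a, 'n, 'c) module_scheme \<Rightarrow> ('a, 'm, 'd) module_scheme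
      \<Rightarrow> ('n \<times> 'm \<Rightarrow>\<^sub>0 int) set"
  where "tensor_subgroup A N M =
    generate (free_Abelian_group (carrier N \<times> carrier M)) (tensor_relations A N M)"

text \<open>The abelian group underlying the tensor product of \<open>N\<close> and \<open>M\<close> over \<open>A\<close>; like
  \<^const>\<open>free_Abelian_group\<close> it is a \<open>monoid\<close> record, so its addition is \<^const>\<open>monoid.mult\<close>.\<close>

definition tensor_product ::
    "('a, 'b) ring_scheme \<Rightarrow> ('a, 'n, 'c) module_scheme \<Rightarrow> ('a, 'm, 'd) module_scheme
      \<Rightarrow> ('n \<times> 'm \<Rightarrow>\<^sub>0 int) set monoid"
  where "tensor_product A N M =
    free_Abelian_group (carrier N \<times> carrier M) Mod tensor_subgroup A N M"

text \<open>The map \<open>\<phi> \<otimes> id\<^sub>M\<close> from \<open>N \<otimes> M\<close> to \<open>N' \<otimes> M\<close> for an \<open>A\<close>-linear map \<open>\<phi>\<close> from \<open>N\<close> to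
  \<open>N'\<close>: the coset of a formal sum of pairs \<open>(x, m)\<close> goes to the coset of the corresponding
  formal sum of pairs \<open>(\<phi> x, m)\<close>.\<close>

definition tensor_map ::
    "('a, 'b) ring_scheme \<Rightarrow> ('a, 'n', 'c) module_scheme \<Rightarrow> ('a, 'm, 'd) module_scheme
      \<Rightarrow> ('n \<Rightarrow> 'n') \<Rightarrow> ('n \<times> 'm \<Rightarrow>\<^sub>0 int) set \<Rightarrow> ('n' \<times> 'm \<Rightarrow>\<^sub>0 int) set"
  where "tensor_map A N' M \<phi> C =
    the_elem ((\<lambda>c. tensor_subgroup A N' M #>\<^bsub>free_Abelian_group (carrier N' \<times> carrier M)\<^esub>
                     frag_extend (\<lambda>(x, m). frag_of (\<phi> x, m)) c) ` C)"

definition restrict_scalars :: "('a \<Rightarrow> 'b) \<Rightarrow> ('b, 'c) ring_scheme \<Rightarrow> ('a, 'b) module"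
  where "restrict_scalars \<phi> B =
    \<lparr>carrier = carrier B, monoid.mult = monoid.mult B, one = one B, ring.zero = ring.zero B, add = add B,
     module.smult = (\<lambda>a b. \<phi> a \<otimes>\<^bsub>B\<^esub> b)\<rparr>"

text \<open>The quantifier over modules ranges over those with elements in the type \<open>'m\<close>. A theorem
  in which \<open>'m\<close> is a free type variable is about all modules.\<close>

definition pure_ring_hom ::
    "'m itself \<Rightarrow> ('a, 'c) ring_scheme \<Rightarrow> ('b, 'd) ring_scheme \<Rightarrow> ('a \<Rightarrow> 'b) \<Rightarrow> bool"
  where "pure_ring_hom TYPE('m) A B \<phi> \<longleftrightarrow>
    \<phi> \<in> ring_hom A B \<and>
    (\<forall>M :: ('a, 'm) module. module A M \<longrightarrow>
       inj_on (tensor_map A (restrict_scalars \<phi> B) M \<phi>)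
         (carrier (tensor_product A (restrict_scalars (\<lambda>a. a) A) M)))"

text \<open>\<open>p \<cdot> 1 = 0\<close> for the prime \<open>p\<close> says that a nonzero \<open>S\<close> has characteristic \<open>p\<close>. The zero
  ring is admitted: it is the associated graded algebra of the unit ideal.\<close>

definition F_pure :: "'m itself \<Rightarrow> nat \<Rightarrow> ('a, 'b) ring_scheme \<Rightarrow> bool"
  where "F_pure TYPE('m) p S \<longleftrightarrow>
    cring S \<and> Factorial_Ring.prime p \<and> add_pow S p \<one>\<^bsub>S\<^esub> = \<zero>\<^bsub>S\<^esub> \<and>
    pure_ring_hom TYPE('m) S S (\<lambda>s. s [^]\<^bsub>S\<^esub> p)"


section \<open>Polynomial rings over perfect fields and square-free monomial ideals\<close>

text \<open>In characteristic \<open>p > 0\<close>, perfect means \<open>k = k\<^sup>p\<close>.\<close>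

definition perfect_field :: "'k::field itself \<Rightarrow> bool"
  where "perfect_field TYPE('k) \<longleftrightarrow> CHAR('k) = 0 \<or> surj (\<lambda>x::'k. x ^ CHAR('k))"

text \<open>\<open>k[x\<^sub>1,\<dots>,x\<^sub>d]\<close>, with the variables numbered from \<open>0\<close> to \<open>d - 1\<close>: an exponent vector is a
  finitely supported function on the variables, and a polynomial a finitely supported function
  on exponent vectors, with the convolution product of \<^theory>\<open>HOL-Library.Poly_Mapping\<close>.\<close>

definition exponents :: "nat \<Rightarrow> (nat \<Rightarrow>\<^sub>0 nat) set"
  where "exponents d = {e. Poly_Mapping.keys e \<subseteq> {..<d}}"

definition mpoly_ring :: "nat \<Rightarrow> ((nat \<Rightarrow>\<^sub>0 nat) \<Rightarrow>\<^sub>0 'k::field) ring"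
  where "mpoly_ring d =
    ring_of_type_algebra\<lparr>carrier := {f. Poly_Mapping.keys f \<subseteq> exponents d}\<rparr>"

definition monomial :: "(nat \<Rightarrow>\<^sub>0 nat) \<Rightarrow> (nat \<Rightarrow>\<^sub>0 nat) \<Rightarrow>\<^sub>0 'k::field"
  where "monomial e = Poly_Mapping.single e 1"

definition squarefree_monomial_ideal :: "nat \<Rightarrow> ((nat \<Rightarrow>\<^sub>0 nat) \<Rightarrow>\<^sub>0 'k::field) set \<Rightarrow> bool"
  where "squarefree_monomial_ideal d I \<longleftrightarrow>
    (\<exists>E \<subseteq> exponents d. (\<forall>e\<in>E. \<forall>i. Poly_Mapping.lookup e i \<le> 1) \<and>
       I = genideal (mpoly_ring d) (monomial ` E))"

end

theory Submission
  imports Defs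
begin

text \<open>
  A ring of characteristic \<open>p\<close> with an additive self-map \<open>\<psi>\<close> satisfying \<open>\<psi> (a\<^sup>p b) = a \<psi> b\<close> and
  \<open>\<psi> 1 = 1\<close> is \<open>F\<close>-pure, because \<open>\<psi>\<close> splits the Frobenius map and a split map stays injective
  after tensoring. On \<open>R = k[x\<^sub>1,\<dots>,x\<^sub>d]\<close> such a map \<open>\<Phi>\<close> sends \<open>c x\<^sup>a\<close> to the monomial \<open>x\<^sup>a\<^sup>/\<^sup>p\<close> with
  coefficient the \<open>p\<close>-th root of \<open>c\<close>, or to \<open>0\<close> if \<open>p\<close> does not divide \<open>a\<close>; on \<open>R[t]\<close> one also
  divides the exponent of \<open>t\<close> by \<open>p\<close>. This map restricts to the symbolic Rees algebra and descends
  to the associated graded algebra once \<open>\<Phi>\<close> maps \<open>I\<^sup>(\<^sup>p\<^sup>n\<^sup>)\<close> into \<open>I\<^sup>(\<^sup>n\<^sup>)\<close> and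
  \<open>I\<^sup>(\<^sup>p\<^sup>n\<^sup>+\<^sup>1\<^sup>)\<close> into \<open>I\<^sup>(\<^sup>n\<^sup>+\<^sup>1\<^sup>)\<close>.

  For this let \<open>P\<close> be a minimal prime of \<open>I\<close> and \<open>C\<close> the set of variables in \<open>P\<close>. If \<open>s f \<in> I\<^sup>m\<close> with
  \<open>s \<notin> P\<close>, then \<open>s\<^sup>p f \<in> I\<^sup>m\<close> has all its monomials of degree at least \<open>m\<close> in the variables of \<open>C\<close>,
  so \<open>\<Phi> (s\<^sup>p f) = s \<Phi> f\<close> has them of degree at least \<open>m / p\<close>. By minimality of \<open>P\<close> each
  variable of \<open>C\<close> is the only one of \<open>C\<close> in some generator of \<open>I\<close>; hence multiplication by the \<open>n\<close>-th
  power of the product of the variables outside \<open>C\<close>, which is not in \<open>P\<close>, takes a polynomial all of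
  whose monomials have degree at least \<open>n\<close> in \<open>C\<close> into \<open>I\<^sup>n\<close>.
\<close>

section \<open>Purity of split ring homomorphisms\<close>

definition linear_map ::
    "('a, 'b) ring_scheme \<Rightarrow> ('a, 'n, 'c) module_scheme \<Rightarrow> ('a, 'm, 'd) module_scheme
      \<Rightarrow> ('n \<Rightarrow> 'm) \<Rightarrow> bool"
  where "linear_map A N N' f \<longleftrightarrow>
    f \<in> carrier N \<rightarrow> carrier N' \<and>
    (\<forall>x\<in>carrier N. \<forall>y\<in>carrier N. f (x \<oplus>\<^bsub>N\<^esub> y) = f x \<oplus>\<^bsub>N'\<^esub> f y) \<and>
    (\<forall>a\<in>carrier A. \<forall>x\<in>carrier N. f (a \<odot>\<^bsub>N\<^esub> x) = a \<odot>\<^bsub>N'\<^esub> f x)"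

lemma module_restrict_scalars:
  assumes "cring A" "cring B" "\<phi> \<in> ring_hom A B"
  shows "module A (restrict_scalars \<phi> B)"
proof -
  interpret B: cring B by fact
  have abelian: "abelian_group (restrict_scalars \<phi> B)"
    by (rule abelian_groupI)
      (auto simp: restrict_scalars_def B.a_assoc B.a_comm B.a_lcomm intro: B.a_inv_closed B.l_neg)
  note hom = ring_hom_closed[OF assms(3)] ring_hom_add[OF assms(3)]
    ring_hom_mult[OF assms(3)] ring_hom_one[OF assms(3)]
  show ?thesis
    by (rule moduleI[OF assms(1) abelian])
      (auto simp: restrict_scalars_def hom B.l_distr B.r_distr B.m_assoc)
qed

text \<open>The lift of \<open>f\<close> tensor identity to formal sums of pairs, before the tensor
  relations are divided out; \<open>tensor_map\<close> is what it induces on cosets.\<close>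

abbreviation tensor_generator_map :: "('n \<Rightarrow> 'n') \<Rightarrow> ('n \<times> 'm \<Rightarrow>\<^sub>0 int) \<Rightarrow> ('n' \<times> 'm \<Rightarrow>\<^sub>0 int)"
  where "tensor_generator_map f \<equiv> frag_extend (\<lambda>(x, m). frag_of (f x, m))"

lemma keys_tensor_generator_map:
  assumes "f \<in> U \<rightarrow> V" "Poly_Mapping.keys c \<subseteq> U \<times> W"
  shows "Poly_Mapping.keys (tensor_generator_map f c) \<subseteq> V \<times> W"
proof (rule order_trans[OF keys_frag_extend], rule UN_least)
  fix z assume "z \<in> Poly_Mapping.keys c"
  then have "z \<in> U \<times> W" using assms(2) by blast
  then show "Poly_Mapping.keys (case z of (x, m) \<Rightarrow> frag_of (f x, m)) \<subseteq> V \<times> W"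
    using assms(1) by (auto split: prod.splits if_splits)
qed

lemma keys_frag_of_diff:
  assumes "u \<in> C" "Poly_Mapping.keys v \<subseteq> C"
  shows "Poly_Mapping.keys (frag_of u - v) \<subseteq> C"
  using assms keys_diff[of "frag_of u" v] by auto

lemma keys_frag_of_diff_diff:
  assumes "u \<in> C" "v \<in> C" "w \<in> C"
  shows "Poly_Mapping.keys (frag_of u - frag_of v - frag_of w) \<subseteq> C"
  using assms keys_frag_of_diff[of u C "frag_of v"] keys_diff[of "frag_of u - frag_of v" "frag_of w"]
  by auto

lemma tensor_relations_subset:
  assumes "module A N" "module A M"
  shows "tensor_relations A N M \<subseteq> carrier (free_Abelian_group (carrier N \<times> carrier M))"
proof -
  interpret N: module A N by fact
  interpret M: module A M by fact
  show ?thesis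
    unfolding tensor_relations_def
    by (intro Un_least subsetI; elim CollectE exE conjE; simp only: carrier_free_Abelian_group_iff)
      ((rule keys_frag_of_diff_diff | rule keys_frag_of_diff); simp)+
qed

lemma subgroup_tensor_subgroup:
  assumes "module A N" "module A M"
  shows "subgroup (tensor_subgroup A N M) (free_Abelian_group (carrier N \<times> carrier M))"
  unfolding tensor_subgroup_def
  using tensor_relations_subset[OF assms] by (intro group.generate_is_subgroup) auto

text \<open>Each kind of relation goes to one of the same kind: additivity of \<open>f\<close>
  handles the first, compatibility with scalars the third, and the second only needs
  \<open>f x\<close> to lie in the carrier of \<open>N'\<close>.\<close>

lemma tensor_generator_map_relations:
  assumes "linear_map A N N' f"
  shows "tensor_generator_map f ` tensor_relations A N M \<subseteq> tensor_relations A N' M"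
proof
  fix z assume "z \<in> tensor_generator_map f ` tensor_relations A N M"
  then obtain r where r: "r \<in> tensor_relations A N M" "z = tensor_generator_map f r" by blast
  from assms have f: "\<And>x. x \<in> carrier N \<Longrightarrow> f x \<in> carrier N'"
    "\<And>x y. x \<in> carrier N \<Longrightarrow> y \<in> carrier N \<Longrightarrow> f (x \<oplus>\<^bsub>N\<^esub> y) = f x \<oplus>\<^bsub>N'\<^esub> f y"
    "\<And>a x. a \<in> carrier A \<Longrightarrow> x \<in> carrier N \<Longrightarrow> f (a \<odot>\<^bsub>N\<^esub> x) = a \<odot>\<^bsub>N'\<^esub> f x"
    unfolding linear_map_def by auto
  from r(1) consider
      x y m where "r = frag_of (x \<oplus>\<^bsub>N\<^esub> y, m) - frag_of (x, m) - frag_of (y, m)"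
        "x \<in> carrier N" "y \<in> carrier N" "m \<in> carrier M"
    | x m m' where "r = frag_of (x, m \<oplus>\<^bsub>M\<^esub> m') - frag_of (x, m) - frag_of (x, m')"
        "x \<in> carrier N" "m \<in> carrier M" "m' \<in> carrier M"
    | a x m where "r = frag_of (a \<odot>\<^bsub>N\<^esub> x, m) - frag_of (x, a \<odot>\<^bsub>M\<^esub> m)"
        "a \<in> carrier A" "x \<in> carrier N" "m \<in> carrier M"
    unfolding tensor_relations_def by blast
  then show "z \<in> tensor_relations A N' M"
  proof cases
    case (1 x y m)
    then have "z = frag_of (f x \<oplus>\<^bsub>N'\<^esub> f y, m) - frag_of (f x, m) - frag_of (f y, m)"
      using r(2) f by (simp add: frag_extend_diff)
    then show ?thesis unfolding tensor_relations_def using 1 f(1) by blast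
  next
    case (2 x m m')
    then have "z = frag_of (f x, m \<oplus>\<^bsub>M\<^esub> m') - frag_of (f x, m) - frag_of (f x, m')"
      using r(2) f by (simp add: frag_extend_diff)
    then show ?thesis unfolding tensor_relations_def using 2 f(1) by blast
  next
    case (3 a x m)
    then have "z = frag_of (a \<odot>\<^bsub>N'\<^esub> f x, m) - frag_of (f x, a \<odot>\<^bsub>M\<^esub> m)"
      using r(2) f by (simp add: frag_extend_diff)
    then show ?thesis unfolding tensor_relations_def using 3 f(1) by blast
  qed
qed

lemma tensor_generator_map_subgroup:
  assumes "module A N" "module A N'" "module A M" "linear_map A N N' f"
    and "c \<in> tensor_subgroup A N M"
  shows "tensor_generator_map f c \<in> tensor_subgroup A N' M"
proof -
  let ?G = "free_Abelian_group (carrier N \<times> carrier M)"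
  let ?H = "free_Abelian_group (carrier N' \<times> carrier M)"
  have f: "f \<in> carrier N \<rightarrow> carrier N'" using assms(4) by (simp add: linear_map_def)
  interpret group_hom ?G ?H "tensor_generator_map f"
    by (intro group_hom.intro group_hom_axioms.intro homI)
      (auto simp: frag_extend_add dest: subsetD[OF keys_tensor_generator_map[OF f]])
  have "tensor_generator_map f c \<in> generate ?H (tensor_generator_map f ` tensor_relations A N M)"
    using generate_img[OF tensor_relations_subset[OF assms(1,3)]] assms(5)
    by (auto simp: tensor_subgroup_def)
  then show ?thesis
    using H.mono_generate[OF tensor_generator_map_relations[OF assms(4)]]
    unfolding tensor_subgroup_def by (rule rev_subsetD)
qed

text \<open>The identity already holds for formal sums, not merely modulo the relations, because it
  holds on each pair \<open>(x, m)\<close>.\<close>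

lemma tensor_generator_map_retract:
  assumes "\<And>x. x \<in> U \<Longrightarrow> g (f x) = x" "Poly_Mapping.keys c \<subseteq> U \<times> W"
  shows "tensor_generator_map g (tensor_generator_map f c) = c"
  using assms(2)
  by (induction c rule: frag_induction) (auto simp: frag_extend_diff assms(1))

text \<open>\<open>tensor_map\<close> is defined through \<open>the_elem\<close>, so it can be
  computed only once the image of a coset is known to be a singleton. Two representatives differ by
  an element of the tensor subgroup, which is sent into the tensor subgroup of the target.\<close>

lemma tensor_map_rcoset:
  assumes "module A N" "module A N'" "module A M" "linear_map A N N' f"
    and c: "Poly_Mapping.keys c \<subseteq> carrier N \<times> carrier M"
  shows "tensor_map A N' M f
      (tensor_subgroup A N M #>\<^bsub>free_Abelian_group (carrier N \<times> carrier M)\<^esub> c) =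
    tensor_subgroup A N' M #>\<^bsub>free_Abelian_group (carrier N' \<times> carrier M)\<^esub>
      tensor_generator_map f c"
proof -
  let ?G = "free_Abelian_group (carrier N \<times> carrier M)"
  let ?H = "free_Abelian_group (carrier N' \<times> carrier M)"
  let ?T = "tensor_subgroup A N' M"
  interpret H: group ?H by simp
  have T: "subgroup ?T ?H" by (rule subgroup_tensor_subgroup) fact+
  have f: "f \<in> carrier N \<rightarrow> carrier N'" using assms(4) by (simp add: linear_map_def)
  note closed = keys_tensor_generator_map[OF f]
  have coset: "?T #>\<^bsub>?H\<^esub> tensor_generator_map f (t + c) = ?T #>\<^bsub>?H\<^esub> tensor_generator_map f c"
    if t: "t \<in> tensor_subgroup A N M" for t
  proof -
    have "tensor_generator_map f t \<in> ?T"
      using t by (rule tensor_generator_map_subgroup[OF assms(1-4)])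
    then have "tensor_generator_map f t \<otimes>\<^bsub>?H\<^esub> tensor_generator_map f c
        \<in> ?T #>\<^bsub>?H\<^esub> tensor_generator_map f c"
      by (rule H.rcosI) (use closed[OF c] subgroup.subset[OF T] in auto)
    then show ?thesis
      using H.repr_independence[OF _ _ T] closed[OF c] by (simp add: frag_extend_add)
  qed
  have "0 \<in> tensor_subgroup A N M"
    using subgroup.one_closed[OF subgroup_tensor_subgroup[OF assms(1,3)]] by simp
  then have "(\<lambda>c. ?T #>\<^bsub>?H\<^esub> tensor_generator_map f c) ` (tensor_subgroup A N M #>\<^bsub>?G\<^esub> c) =
      {?T #>\<^bsub>?H\<^esub> tensor_generator_map f c}"
    unfolding r_coset_def[of ?G] using coset by auto
  then show ?thesis by (simp add: tensor_map_def)
qed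

text \<open>If the images of \<open>c\<close> and \<open>d\<close> agree modulo the relations, then
  the image of \<open>c - d\<close> lies in the tensor subgroup of the target; applying
  \<open>g\<close> brings back \<open>c - d\<close> itself, now in the tensor subgroup of the
  source.\<close>

lemma inj_on_tensor_map_of_retraction:
  assumes "module A N" "module A N'" "module A M" "linear_map A N N' f" "linear_map A N' N g"
    and retr: "\<And>x. x \<in> carrier N \<Longrightarrow> g (f x) = x"
  shows "inj_on (tensor_map A N' M f) (carrier (tensor_product A N M))"
proof (rule inj_onI)
  let ?G = "free_Abelian_group (carrier N \<times> carrier M)"
  let ?H = "free_Abelian_group (carrier N' \<times> carrier M)"
  interpret G: group ?G by simp
  interpret H: group ?H by simp
  have T: "subgroup (tensor_subgroup A N M) ?G" "subgroup (tensor_subgroup A N' M) ?H"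
    by (rule subgroup_tensor_subgroup; fact)+
  have f: "f \<in> carrier N \<rightarrow> carrier N'" using assms(4) by (simp add: linear_map_def)
  fix C D
  assume "C \<in> carrier (tensor_product A N M)" "D \<in> carrier (tensor_product A N M)"
    and eq: "tensor_map A N' M f C = tensor_map A N' M f D"
  then obtain c d where c: "Poly_Mapping.keys c \<subseteq> carrier N \<times> carrier M"
      "C = tensor_subgroup A N M #>\<^bsub>?G\<^esub> c"
    and d: "Poly_Mapping.keys d \<subseteq> carrier N \<times> carrier M" "D = tensor_subgroup A N M #>\<^bsub>?G\<^esub> d"
    unfolding tensor_product_def FactGroup_def RCOSETS_def by auto
  have cd: "Poly_Mapping.keys (c - d) \<subseteq> carrier N \<times> carrier M"
    using c(1) d(1) keys_diff[of c d] by blast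
  note closed = keys_tensor_generator_map[OF f]
  have "tensor_subgroup A N' M #>\<^bsub>?H\<^esub> tensor_generator_map f c =
      tensor_subgroup A N' M #>\<^bsub>?H\<^esub> tensor_generator_map f d"
    using eq unfolding c(2) d(2) tensor_map_rcoset[OF assms(1-4) c(1)]
      tensor_map_rcoset[OF assms(1-4) d(1)] .
  then have "tensor_generator_map f c \<otimes>\<^bsub>?H\<^esub> inv\<^bsub>?H\<^esub> tensor_generator_map f d
      \<in> tensor_subgroup A N' M"
    using closed[OF c(1)] closed[OF d(1)] H.rcos_self[OF _ T(2)]
    by (intro subgroup.rcos_module_imp[OF T(2)]) auto
  then have "tensor_generator_map f (c - d) \<in> tensor_subgroup A N' M"
    using closed[OF d(1)] by (simp add: frag_extend_diff)
  then have "tensor_generator_map g (tensor_generator_map f (c - d)) \<in> tensor_subgroup A N M"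
    by (rule tensor_generator_map_subgroup[OF assms(2,1,3,5)])
  then have "c - d \<in> tensor_subgroup A N M"
    by (simp add: tensor_generator_map_retract[where f = f and g = g, OF retr cd])
  then have "c \<otimes>\<^bsub>?G\<^esub> inv\<^bsub>?G\<^esub> d \<in> tensor_subgroup A N M" using d(1) by simp
  then have "c \<in> tensor_subgroup A N M #>\<^bsub>?G\<^esub> d"
    using c(1) d(1) by (intro subgroup.rcos_module_rev[OF T(1)]) auto
  then show "C = D"
    using G.repr_independence[OF _ _ T(1)] c d by simp
qed

text \<open>With \<open>B\<close> regarded as an \<open>A\<close>-module through
  \<open>\<phi>\<close>, the map \<open>\<psi>\<close> is \<open>A\<close>-linear and sends 1 to 1,
  hence is a left inverse of \<open>\<phi>\<close>:
  \<open>\<psi> (\<phi> a) = a \<psi> 1 = a\<close>. The retraction argument then applies to every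
  module \<open>M\<close>.\<close>

lemma pure_ring_hom_of_splitting:
  assumes "cring A" "cring B" and \<phi>: "\<phi> \<in> ring_hom A B"
    and \<psi>: "\<psi> \<in> carrier B \<rightarrow> carrier A"
    and add: "\<And>x y. x \<in> carrier B \<Longrightarrow> y \<in> carrier B \<Longrightarrow> \<psi> (x \<oplus>\<^bsub>B\<^esub> y) = \<psi> x \<oplus>\<^bsub>A\<^esub> \<psi> y"
    and lin: "\<And>a x. a \<in> carrier A \<Longrightarrow> x \<in> carrier B \<Longrightarrow> \<psi> (\<phi> a \<otimes>\<^bsub>B\<^esub> x) = a \<otimes>\<^bsub>A\<^esub> \<psi> x"
    and one: "\<psi> \<one>\<^bsub>B\<^esub> = \<one>\<^bsub>A\<^esub>"
  shows "pure_ring_hom TYPE('m) A B \<phi>"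
  unfolding pure_ring_hom_def
proof (intro conjI allI impI)
  interpret A: cring A by fact
  interpret B: cring B by fact
  note hom = ring_hom_closed[OF \<phi>] ring_hom_add[OF \<phi>] ring_hom_mult[OF \<phi>] ring_hom_one[OF \<phi>]
  fix M :: "('a, 'm) module" assume M: "module A M"
  let ?N = "restrict_scalars (\<lambda>a. a) A" and ?N' = "restrict_scalars \<phi> B"
  have retr: "\<psi> (\<phi> a) = a" if "a \<in> carrier A" for a
    using lin[OF that B.one_closed] hom(1)[OF that] that by (simp add: one)
  have "(\<lambda>a. a) \<in> ring_hom A A" by (auto simp: ring_hom_def)
  with M show "inj_on (tensor_map A ?N' M \<phi>) (carrier (tensor_product A ?N M))"
    by (intro inj_on_tensor_map_of_retraction[where g = \<psi>] module_restrict_scalars assms)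
      (use \<psi> add lin hom retr in \<open>auto simp: linear_map_def restrict_scalars_def\<close>)
qed fact

section \<open>From a splitting on a type to \<open>F\<close>-purity of an image ring\<close>

text \<open>The ring axioms of \<open>S\<close> are inherited along \<open>h\<close> from arithmetic
  in the class \<open>comm_ring_1\<close>. This serves the polynomial ring, with \<open>h\<close>
  the identity, and both symbolic algebras.\<close>

lemma cring_surjective_image:
  fixes B :: "'a::comm_ring_1 set"
  assumes B: "1 \<in> B" "\<And>x y. x \<in> B \<Longrightarrow> y \<in> B \<Longrightarrow> x + y \<in> B" "\<And>x y. x \<in> B \<Longrightarrow> y \<in> B \<Longrightarrow> x * y \<in> B"
      "\<And>x. x \<in> B \<Longrightarrow> - x \<in> B"
    and surj: "h ` B = carrier S"
    and h: "\<And>x y. x \<in> B \<Longrightarrow> y \<in> B \<Longrightarrow> h (x + y) = h x \<oplus>\<^bsub>S\<^esub> h y"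
      "\<And>x y. x \<in> B \<Longrightarrow> y \<in> B \<Longrightarrow> h (x * y) = h x \<otimes>\<^bsub>S\<^esub> h y"
      "h 1 = \<one>\<^bsub>S\<^esub>" "h 0 = \<zero>\<^bsub>S\<^esub>"
  shows "cring S"
proof (intro cringI abelian_groupI comm_monoidI; unfold surj[symmetric]; (elim imageE; hypsubst)?)
  note [simp] = h[symmetric]
  have "1 + - 1 \<in> B" using B(1,2,4) by blast
  then have "0 \<in> B" by simp
  note [simp] = this B
  show "h x \<oplus>\<^bsub>S\<^esub> h y \<in> h ` B" "h x \<otimes>\<^bsub>S\<^esub> h y \<in> h ` B" if "x \<in> B" "y \<in> B" for x y
    using that by auto
  show "\<zero>\<^bsub>S\<^esub> \<in> h ` B" "\<one>\<^bsub>S\<^esub> \<in> h ` B" by auto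
  show "\<zero>\<^bsub>S\<^esub> \<oplus>\<^bsub>S\<^esub> h x = h x" "\<one>\<^bsub>S\<^esub> \<otimes>\<^bsub>S\<^esub> h x = h x" if "x \<in> B" for x
    using that by (auto simp del: h(3,4) simp: h(3,4)[symmetric])
  show "\<exists>y\<in>h ` B. y \<oplus>\<^bsub>S\<^esub> h x = \<zero>\<^bsub>S\<^esub>" if "x \<in> B" for x
    using that by (intro bexI[of _ "h (- x)"]) auto
qed (auto simp: B h[symmetric] algebra_simps)

text \<open>The map \<open>\<psi>\<close> splits Frobenius on the whole type and preserves
  \<open>B\<close>; as it also preserves the kernel of \<open>h\<close> on \<open>B\<close>, it
  descends to \<open>S\<close>. For the Rees algebra \<open>h\<close> is injective, for the
  associated graded algebra it is the quotient map.\<close>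

lemma F_pure_of_splitting:
  fixes B :: "'a::comm_ring_1 set"
  assumes p: "Factorial_Ring.prime p" "CHAR('a) = p"
    and B: "1 \<in> B" "\<And>x y. x \<in> B \<Longrightarrow> y \<in> B \<Longrightarrow> x + y \<in> B" "\<And>x y. x \<in> B \<Longrightarrow> y \<in> B \<Longrightarrow> x * y \<in> B"
      "\<And>x. x \<in> B \<Longrightarrow> - x \<in> B"
    and surj: "h ` B = carrier S"
    and h: "\<And>x y. x \<in> B \<Longrightarrow> y \<in> B \<Longrightarrow> h (x + y) = h x \<oplus>\<^bsub>S\<^esub> h y"
      "\<And>x y. x \<in> B \<Longrightarrow> y \<in> B \<Longrightarrow> h (x * y) = h x \<otimes>\<^bsub>S\<^esub> h y"
      "h 1 = \<one>\<^bsub>S\<^esub>" "h 0 = \<zero>\<^bsub>S\<^esub>"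
    and \<psi>: "\<And>x. x \<in> B \<Longrightarrow> \<psi> x \<in> B" "\<And>x y. \<psi> (x + y) = \<psi> x + \<psi> y"
      "\<And>x y. \<psi> (x ^ p * y) = x * \<psi> y" "\<psi> 1 = 1"
    and ker: "\<And>x. x \<in> B \<Longrightarrow> h x = \<zero>\<^bsub>S\<^esub> \<Longrightarrow> h (\<psi> x) = \<zero>\<^bsub>S\<^esub>"
  shows "F_pure TYPE('m) p S"
proof -
  have cring: "cring S"
    by (rule cring_surjective_image[where B = B and h = h]) (fact B surj h)+
  interpret S: cring S by fact
  have hB: "h x \<in> carrier S" if "x \<in> B" for x using that surj by blast
  have B_pow: "x ^ n \<in> B" if "x \<in> B" for x n using that B by (induction n) auto
  have h_pow: "h (x ^ n) = h x [^]\<^bsub>S\<^esub> n" if "x \<in> B" for x n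
    using that by (induction n) (auto simp: h B_pow hB S.m_comm)
  have B_0: "0 \<in> B" using B(2)[OF B(1) B(4)[OF B(1)]] by simp
  have B_of_nat: "of_nat n \<in> B" for n by (induction n) (auto simp: B B_0)
  have h_of_nat: "h (of_nat n) = add_pow S n \<one>\<^bsub>S\<^esub>" for n
    by (induction n) (auto simp: h B B_of_nat S.a_comm)
  have dream: "(x + y) ^ p = x ^ p + y ^ p" for x y :: 'a
    using p by (intro freshmans_dream) auto
  have frob: "(\<lambda>s. s [^]\<^bsub>S\<^esub> p) \<in> ring_hom S S"
  proof (intro ring_hom_memI)
    fix s t assume "s \<in> carrier S" "t \<in> carrier S"
    then obtain x y where xy: "x \<in> B" "s = h x" "y \<in> B" "t = h y" unfolding surj[symmetric] by blast
    then show "(s \<oplus>\<^bsub>S\<^esub> t) [^]\<^bsub>S\<^esub> p = s [^]\<^bsub>S\<^esub> p \<oplus>\<^bsub>S\<^esub> t [^]\<^bsub>S\<^esub> p"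
      by (simp add: h(1)[symmetric] h_pow[symmetric] B B_pow dream)
  qed (auto simp: S.nat_pow_distrib)
  \<comment> \<open>A set-theoretic section of \<open>h\<close>, used to write down the descended
    map; by \<open>h_eq\<close> the choice does not matter.\<close>
  define g where "g s = (SOME x. x \<in> B \<and> h x = s)" for s
  have g: "g s \<in> B" "h (g s) = s" if "s \<in> carrier S" for s
    using that someI_ex[of "\<lambda>x. x \<in> B \<and> h x = s"] unfolding surj[symmetric] g_def by blast+
  have \<psi>_0: "\<psi> 0 = 0" using \<psi>(2)[of 0 0] by simp
  have \<psi>_diff: "\<psi> (x - y) = \<psi> x - \<psi> y" for x y
    using \<psi>(2)[of "x - y" y] by (simp add: algebra_simps)
  \<comment> \<open>Preservation of the kernel, applied to \<open>x - y\<close>, becomes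
    independence of the representative.\<close>
  have h_eq: "h (\<psi> x) = h (\<psi> y)" if "x \<in> B" "y \<in> B" "h x = h y" for x y
  proof -
    have d: "h (u - v) = h u \<ominus>\<^bsub>S\<^esub> h v" if uv: "u \<in> B" "v \<in> B" for u v
    proof -
      have "u - v \<in> B" using B(2)[OF uv(1) B(4)[OF uv(2)]] by simp
      then have "h u = h (u - v) \<oplus>\<^bsub>S\<^esub> h v" using uv h(1)[of "u - v" v] by simp
      then show ?thesis using hB \<open>u - v \<in> B\<close> uv by (simp add: a_minus_def S.a_assoc S.r_neg)
    qed
    have "h (x - y) = \<zero>\<^bsub>S\<^esub>" using d[OF that(1,2)] that(3) hB that(1,2) by (simp add: S.r_neg a_minus_def)
    moreover have "x - y \<in> B" using B(2)[OF that(1) B(4)[OF that(2)]] by simp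
    ultimately have "h (\<psi> (x - y)) = \<zero>\<^bsub>S\<^esub>" using ker by blast
    then have "h (\<psi> x) \<ominus>\<^bsub>S\<^esub> h (\<psi> y) = \<zero>\<^bsub>S\<^esub>" using d \<psi>(1) that by (simp add: \<psi>_diff)
    then show ?thesis using hB \<psi>(1) that by (simp add: S.r_right_minus_eq)
  qed
  let ?\<psi> = "\<lambda>s. h (\<psi> (g s))"
  have \<psi>_h: "?\<psi> (h x) = h (\<psi> x)" if "x \<in> B" for x
    using g[OF hB[OF that]] that by (intro h_eq) auto
  have "pure_ring_hom TYPE('m) S S (\<lambda>s. s [^]\<^bsub>S\<^esub> p)"
  proof (rule pure_ring_hom_of_splitting[OF cring cring frob, where \<psi> = ?\<psi>])
    show "?\<psi> \<in> carrier S \<rightarrow> carrier S" using g \<psi>(1) hB by blast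
    fix s t assume "s \<in> carrier S" "t \<in> carrier S"
    then obtain x y where xy: "x \<in> B" "s = h x" "y \<in> B" "t = h y" unfolding surj[symmetric] by blast
    show "?\<psi> (s \<oplus>\<^bsub>S\<^esub> t) = ?\<psi> s \<oplus>\<^bsub>S\<^esub> ?\<psi> t"
      using xy B \<psi> by (simp add: h(1)[symmetric] \<psi>_h)
    have "?\<psi> (h (x ^ p * y)) = h x \<otimes>\<^bsub>S\<^esub> ?\<psi> (h y)"
      using xy B B_pow \<psi> by (simp add: \<psi>_h h(2)[OF xy(1) \<psi>(1)[OF xy(3)]])
    then show "?\<psi> (s [^]\<^bsub>S\<^esub> p \<otimes>\<^bsub>S\<^esub> t) = s \<otimes>\<^bsub>S\<^esub> ?\<psi> t"
      using xy by (simp add: h(2) h_pow B_pow)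
  next
    show "?\<psi> \<one>\<^bsub>S\<^esub> = \<one>\<^bsub>S\<^esub>" using \<psi>_h[OF B(1)] by (simp add: h \<psi>)
  qed
  moreover have "add_pow S p \<one>\<^bsub>S\<^esub> = \<zero>\<^bsub>S\<^esub>"
    using h_of_nat[of p] h(4) p(2) by (metis of_nat_CHAR)
  ultimately show ?thesis using p(1) cring by (simp add: F_pure_def)
qed

section \<open>Localization and symbolic powers in a commutative ring\<close>

locale multiplicative_set = cring R for R (structure) +
  fixes S
  assumes S_sub: "S \<subseteq> carrier R" and S_one: "\<one> \<in> S"
    and S_mult: "s \<in> S \<Longrightarrow> t \<in> S \<Longrightarrow> s \<otimes> t \<in> S"
begin

lemma S_carrier [simp]: "s \<in> S \<Longrightarrow> s \<in> carrier R"
  using S_sub by blast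

lemmas S_closed [simp] = S_one S_mult

abbreviation "fr \<equiv> fraction R S"

lemma fraction_rel_iff:
  "((a, s), (b, t)) \<in> fraction_rel R S \<longleftrightarrow>
    a \<in> carrier R \<and> s \<in> S \<and> b \<in> carrier R \<and> t \<in> S \<and> (\<exists>u\<in>S. u \<otimes> (a \<otimes> t) = u \<otimes> (b \<otimes> s))"
proof -
  have "u \<otimes> (a \<otimes> t \<ominus> b \<otimes> s) = \<zero> \<longleftrightarrow> u \<otimes> (a \<otimes> t) = u \<otimes> (b \<otimes> s)"
    if "a \<in> carrier R" "s \<in> S" "b \<in> carrier R" "t \<in> S" "u \<in> S" for u
    using that by (simp add: a_minus_def r_distr r_minus r_right_minus_eq[unfolded a_minus_def])
  then show ?thesis unfolding fraction_rel_def by blast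
qed

lemma equiv_fraction_rel: "equiv (carrier R \<times> S) (fraction_rel R S)"
proof (rule equivI)
  show "fraction_rel R S \<subseteq> (carrier R \<times> S) \<times> carrier R \<times> S" by (auto simp: fraction_rel_iff)
  show "refl_on (carrier R \<times> S) (fraction_rel R S)"
    unfolding refl_on_def using S_one by (auto simp: fraction_rel_iff)
  show "sym (fraction_rel R S)"
  proof (rule symI)
    fix x y assume "(x, y) \<in> fraction_rel R S"
    then show "(y, x) \<in> fraction_rel R S"
      by (cases x; cases y) (simp only: fraction_rel_iff, metis)
  qed
  show "trans (fraction_rel R S)"
  proof (rule transI)
    fix x y z assume *: "(x, y) \<in> fraction_rel R S" "(y, z) \<in> fraction_rel R S"
    obtain a s where x: "x = (a, s)" by fastforce
    obtain b t where y: "y = (b, t)" by fastforce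
    obtain c r where z: "z = (c, r)" by fastforce
    obtain u v where car: "a \<in> carrier R" "s \<in> S" "b \<in> carrier R" "t \<in> S" "c \<in> carrier R" "r \<in> S"
        "u \<in> S" "v \<in> S"
      and u: "u \<otimes> (a \<otimes> t) = u \<otimes> (b \<otimes> s)" and v: "v \<otimes> (b \<otimes> r) = v \<otimes> (c \<otimes> t)"
      using * unfolding x y z fraction_rel_iff by blast
    \<comment> \<open>The witness for transitivity contains the middle denominator \<open>t\<close>
      besides \<open>u\<close> and \<open>v\<close>, so that both given equations can be used after
      reordering the factors.\<close>
    have "u \<otimes> v \<otimes> t \<otimes> (a \<otimes> r) = v \<otimes> r \<otimes> (u \<otimes> (a \<otimes> t))" using car by (simp add: m_ac)
    also have "\<dots> = u \<otimes> s \<otimes> (v \<otimes> (b \<otimes> r))" unfolding u using car by (simp add: m_ac)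
    also have "\<dots> = u \<otimes> v \<otimes> t \<otimes> (c \<otimes> s)" unfolding v using car by (simp add: m_ac)
    finally show "(x, z) \<in> fraction_rel R S"
      unfolding x z fraction_rel_iff using car by (auto intro!: bexI[of _ "u \<otimes> v \<otimes> t"])
  qed
qed

lemma fraction_eq_iff:
  assumes "a \<in> carrier R" "s \<in> S" "b \<in> carrier R" "t \<in> S"
  shows "fr a s = fr b t \<longleftrightarrow> (\<exists>u\<in>S. u \<otimes> (a \<otimes> t) = u \<otimes> (b \<otimes> s))"
  unfolding fraction_def using eq_equiv_class_iff[OF equiv_fraction_rel, of "(a, s)" "(b, t)"] assms
  by (auto simp: fraction_rel_iff)

lemma fraction_eqI:
  assumes "a \<otimes> t = b \<otimes> s" "a \<in> carrier R" "s \<in> S" "b \<in> carrier R" "t \<in> S"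
  shows "fr a s = fr b t"
  using assms S_one by (auto simp: fraction_eq_iff)

lemma fraction_zero: "s \<in> S \<Longrightarrow> fr \<zero> s = fr \<zero> \<one>"
  by (rule fraction_eqI) simp_all

abbreviation "Loc \<equiv> localization R S"

lemma carrier_localization: "carrier Loc = {fr a s | a s. a \<in> carrier R \<and> s \<in> S}"
  unfolding localization_def fraction_def quotient_def by auto

text \<open>The product is a union over all pairs of representatives. Every pair gives the same
  class, with the product of the two cancelling factors as witness, and the index sets are nonempty,
  so the union is that class.\<close>

lemma mult_fraction:
  assumes "a \<in> carrier R" "s \<in> S" "b \<in> carrier R" "t \<in> S"
  shows "fr a s \<otimes>\<^bsub>Loc\<^esub> fr b t = fr (a \<otimes> b) (s \<otimes> t)"
proof -
  have "fr (fst x \<otimes> fst y) (snd x \<otimes> snd y) = fr (a \<otimes> b) (s \<otimes> t)"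
    if xy: "x \<in> fr a s" "y \<in> fr b t" for x y
  proof -
    obtain a' s' where x: "x = (a', s')" by fastforce
    obtain b' t' where y: "y = (b', t')" by fastforce
    obtain u v where car: "a' \<in> carrier R" "s' \<in> S" "b' \<in> carrier R" "t' \<in> S" "u \<in> S" "v \<in> S"
      and u: "u \<otimes> (a \<otimes> s') = u \<otimes> (a' \<otimes> s)" and v: "v \<otimes> (b \<otimes> t') = v \<otimes> (b' \<otimes> t)"
      using xy unfolding x y fraction_def Image_singleton_iff fraction_rel_iff by blast
    have "u \<otimes> v \<otimes> (a' \<otimes> b' \<otimes> (s \<otimes> t)) = (u \<otimes> (a' \<otimes> s)) \<otimes> (v \<otimes> (b' \<otimes> t))"
      using car assms by (simp add: m_ac)
    also have "\<dots> = u \<otimes> v \<otimes> (a \<otimes> b \<otimes> (s' \<otimes> t'))"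
      unfolding u[symmetric] v[symmetric] using car assms by (simp add: m_ac)
    finally show ?thesis
      using car assms by (auto simp: x y fraction_eq_iff intro!: bexI[of _ "u \<otimes> v"])
  qed
  moreover have "(a, s) \<in> fr a s" "(b, t) \<in> fr b t"
    using assms S_one by (auto simp: fraction_def fraction_rel_iff)
  ultimately show ?thesis unfolding localization_def by (auto 0 3)
qed

lemma add_fraction:
  assumes "a \<in> carrier R" "s \<in> S" "b \<in> carrier R" "t \<in> S"
  shows "fr a s \<oplus>\<^bsub>Loc\<^esub> fr b t = fr (a \<otimes> t \<oplus> b \<otimes> s) (s \<otimes> t)"
proof -
  have "fr (fst x \<otimes> snd y \<oplus> fst y \<otimes> snd x) (snd x \<otimes> snd y) = fr (a \<otimes> t \<oplus> b \<otimes> s) (s \<otimes> t)"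
    if xy: "x \<in> fr a s" "y \<in> fr b t" for x y
  proof -
    obtain a' s' where x: "x = (a', s')" by fastforce
    obtain b' t' where y: "y = (b', t')" by fastforce
    obtain u v where car: "a' \<in> carrier R" "s' \<in> S" "b' \<in> carrier R" "t' \<in> S" "u \<in> S" "v \<in> S"
      and u: "u \<otimes> (a \<otimes> s') = u \<otimes> (a' \<otimes> s)" and v: "v \<otimes> (b \<otimes> t') = v \<otimes> (b' \<otimes> t)"
      using xy unfolding x y fraction_def Image_singleton_iff fraction_rel_iff by blast
    have "u \<otimes> v \<otimes> ((a' \<otimes> t' \<oplus> b' \<otimes> s') \<otimes> (s \<otimes> t)) =
        (u \<otimes> (a' \<otimes> s)) \<otimes> (v \<otimes> (t \<otimes> t')) \<oplus> (v \<otimes> (b' \<otimes> t)) \<otimes> (u \<otimes> (s \<otimes> s'))"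
      using car assms by (simp add: m_ac l_distr r_distr)
    also have "\<dots> = u \<otimes> v \<otimes> ((a \<otimes> t \<oplus> b \<otimes> s) \<otimes> (s' \<otimes> t'))"
      unfolding u[symmetric] v[symmetric] using car assms by (simp add: m_ac l_distr r_distr)
    finally show ?thesis
      using car assms by (auto simp: x y fraction_eq_iff intro!: bexI[of _ "u \<otimes> v"])
  qed
  moreover have "(a, s) \<in> fr a s" "(b, t) \<in> fr b t"
    using assms S_one by (auto simp: fraction_def fraction_rel_iff)
  ultimately show ?thesis unfolding localization_def by (auto 0 3)
qed

lemma one_localization: "\<one>\<^bsub>Loc\<^esub> = fr \<one> \<one>" and zero_localization: "\<zero>\<^bsub>Loc\<^esub> = fr \<zero> \<one>"
  by (simp_all add: localization_def)

lemma fraction_closed [simp]: "a \<in> carrier R \<Longrightarrow> s \<in> S \<Longrightarrow> fr a s \<in> carrier Loc"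
  unfolding carrier_localization by blast

lemma localization_cases:
  assumes "z \<in> carrier Loc"
  obtains a s where "a \<in> carrier R" "s \<in> S" "z = fr a s"
  using assms unfolding carrier_localization by blast

lemma cring_localization: "cring Loc"
proof (intro cringI abelian_groupI comm_monoidI)
  fix x assume "x \<in> carrier Loc"
  then obtain a s where x: "a \<in> carrier R" "s \<in> S" "x = fr a s" by (rule localization_cases)
  show "\<zero>\<^bsub>Loc\<^esub> \<oplus>\<^bsub>Loc\<^esub> x = x" "\<one>\<^bsub>Loc\<^esub> \<otimes>\<^bsub>Loc\<^esub> x = x"
    using x by (simp_all add: zero_localization one_localization add_fraction mult_fraction)
  show "\<exists>y\<in>carrier Loc. y \<oplus>\<^bsub>Loc\<^esub> x = \<zero>\<^bsub>Loc\<^esub>"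
    using x by (intro bexI[of _ "fr (\<ominus> a) s"])
      (simp_all add: zero_localization add_fraction l_minus l_neg fraction_zero[of "s \<otimes> s"])
  fix y assume "y \<in> carrier Loc"
  then obtain b t where y: "b \<in> carrier R" "t \<in> S" "y = fr b t" by (rule localization_cases)
  show "x \<oplus>\<^bsub>Loc\<^esub> y \<in> carrier Loc" "x \<otimes>\<^bsub>Loc\<^esub> y \<in> carrier Loc"
    using x y by (simp_all add: add_fraction mult_fraction)
  show "x \<oplus>\<^bsub>Loc\<^esub> y = y \<oplus>\<^bsub>Loc\<^esub> x" "x \<otimes>\<^bsub>Loc\<^esub> y = y \<otimes>\<^bsub>Loc\<^esub> x"
    using x y by (simp_all add: add_fraction mult_fraction m_comm a_comm)
  fix z assume "z \<in> carrier Loc"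
  then obtain c r where z: "c \<in> carrier R" "r \<in> S" "z = fr c r" by (rule localization_cases)
  show "x \<oplus>\<^bsub>Loc\<^esub> y \<oplus>\<^bsub>Loc\<^esub> z = x \<oplus>\<^bsub>Loc\<^esub> (y \<oplus>\<^bsub>Loc\<^esub> z)"
    "x \<otimes>\<^bsub>Loc\<^esub> y \<otimes>\<^bsub>Loc\<^esub> z = x \<otimes>\<^bsub>Loc\<^esub> (y \<otimes>\<^bsub>Loc\<^esub> z)"
    using x y z by (simp_all add: add_fraction mult_fraction m_ac a_ac l_distr r_distr)
  show "(x \<oplus>\<^bsub>Loc\<^esub> y) \<otimes>\<^bsub>Loc\<^esub> z = x \<otimes>\<^bsub>Loc\<^esub> z \<oplus>\<^bsub>Loc\<^esub> y \<otimes>\<^bsub>Loc\<^esub> z"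
    using x y z
    by (simp add: add_fraction mult_fraction, intro fraction_eqI)
      (simp_all add: m_ac a_ac l_distr r_distr)
qed (simp_all add: zero_localization one_localization)

text \<open>The fractions with numerator in \<open>J\<close> form an ideal containing the image of
  \<open>J\<close>, hence contain the extended ideal; clearing denominators in
  \<open>r / 1 = a / s\<close> gives \<open>u s r = u a\<close>, which lies in \<open>J\<close>.
  Conversely \<open>r / 1\<close> is the product of \<open>1 / s\<close> and
  \<open>s r / 1\<close>.\<close>

lemma fraction_in_extended_ideal_iff:
  assumes J: "ideal J R" and r: "r \<in> carrier R"
  shows "fr r \<one> \<in> genideal Loc ((\<lambda>x. fr x \<one>) ` J) \<longleftrightarrow> (\<exists>s\<in>S. s \<otimes> r \<in> J)"
proof
  interpret J: ideal J R by fact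
  interpret L: cring Loc by (rule cring_localization)
  let ?K = "{fr a s | a s. a \<in> J \<and> s \<in> S}"
  have "ideal ?K Loc"
  proof (rule idealI)
    show "ring Loc" by (rule L.ring_axioms)
    show "subgroup ?K (add_monoid Loc)"
    proof (rule subgroup.intro)
      show "?K \<subseteq> carrier (add_monoid Loc)" by auto
      have "\<zero>\<^bsub>Loc\<^esub> \<in> ?K"
        using J.zero_closed S_one unfolding zero_localization by blast
      then show "\<one>\<^bsub>add_monoid Loc\<^esub> \<in> ?K" by simp
    next
      fix x y assume "x \<in> ?K" "y \<in> ?K"
      then obtain a s b t where *: "x = fr a s" "a \<in> J" "s \<in> S" "y = fr b t" "b \<in> J" "t \<in> S" by blast
      then have "x \<oplus>\<^bsub>Loc\<^esub> y = fr (a \<otimes> t \<oplus> b \<otimes> s) (s \<otimes> t)" by (simp add: add_fraction)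
      moreover have "a \<otimes> t \<oplus> b \<otimes> s \<in> J" using * by (simp add: J.I_r_closed)
      ultimately have "x \<oplus>\<^bsub>Loc\<^esub> y \<in> ?K" using S_mult[OF *(3,6)] by blast
      then show "x \<otimes>\<^bsub>add_monoid Loc\<^esub> y \<in> ?K" by simp
    next
      fix x assume "x \<in> ?K"
      then obtain a s where *: "x = fr a s" "a \<in> J" "s \<in> S" by blast
      have "fr (\<ominus> a) s \<oplus>\<^bsub>Loc\<^esub> x = \<zero>\<^bsub>Loc\<^esub>"
        using * by (simp add: zero_localization add_fraction l_minus l_neg fraction_zero[of "s \<otimes> s"])
      then have "\<ominus>\<^bsub>Loc\<^esub> x = fr (\<ominus> a) s"
        using * by (intro L.minus_equality) auto
      moreover have "\<ominus> a \<in> J" using * by simp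
      ultimately show "inv\<^bsub>add_monoid Loc\<^esub> x \<in> ?K"
        using * unfolding a_inv_def[symmetric] by blast
    qed
  next
    fix x z assume x: "x \<in> ?K" and "z \<in> carrier Loc"
    then obtain a s b t where *: "x = fr a s" "a \<in> J" "s \<in> S" "z = fr b t" "b \<in> carrier R" "t \<in> S"
      unfolding carrier_localization by blast
    have "z \<otimes>\<^bsub>Loc\<^esub> x = fr (b \<otimes> a) (t \<otimes> s)" "x \<otimes>\<^bsub>Loc\<^esub> z = fr (a \<otimes> b) (s \<otimes> t)"
      using * by (simp_all add: mult_fraction)
    then show "z \<otimes>\<^bsub>Loc\<^esub> x \<in> ?K" "x \<otimes>\<^bsub>Loc\<^esub> z \<in> ?K"
      using J.I_l_closed[OF *(2,5)] J.I_r_closed[OF *(2,5)] S_mult[OF *(3,6)] S_mult[OF *(6,3)]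
      by blast+
  qed
  moreover have "(\<lambda>x. fr x \<one>) ` J \<subseteq> ?K" using S_one by blast
  moreover assume "fr r \<one> \<in> genideal Loc ((\<lambda>x. fr x \<one>) ` J)"
  ultimately have "fr r \<one> \<in> ?K" unfolding genideal_def by blast
  then obtain a s where *: "fr r \<one> = fr a s" "a \<in> J" "s \<in> S" by blast
  then obtain u where u: "u \<in> S" "u \<otimes> (r \<otimes> s) = u \<otimes> (a \<otimes> \<one>)"
    using r by (auto simp: fraction_eq_iff)
  then have "(u \<otimes> s) \<otimes> r = u \<otimes> a" using r * by (simp add: m_ac)
  also have "\<dots> \<in> J" using u * by (simp add: J.I_l_closed)
  finally show "\<exists>s\<in>S. s \<otimes> r \<in> J" using u * by (intro bexI[of _ "u \<otimes> s"]) auto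
next
  assume "\<exists>s\<in>S. s \<otimes> r \<in> J"
  then obtain s where s: "s \<in> S" "s \<otimes> r \<in> J" by blast
  have "fr r \<one> \<in> K" if K: "ideal K Loc" "(\<lambda>x. fr x \<one>) ` J \<subseteq> K" for K
  proof -
    have "fr \<one> s \<otimes>\<^bsub>Loc\<^esub> fr (s \<otimes> r) \<one> \<in> K"
      using K s by (intro ideal.I_l_closed[OF K(1)]) auto
    moreover have "fr \<one> s \<otimes>\<^bsub>Loc\<^esub> fr (s \<otimes> r) \<one> = fr r \<one>"
      using s r by (simp add: mult_fraction, intro fraction_eqI) (simp_all add: m_ac)
    ultimately show ?thesis by simp
  qed
  then show "fr r \<one> \<in> genideal Loc ((\<lambda>x. fr x \<one>) ` J)" unfolding genideal_def by blast
qed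

end

section \<open>Contraction and symbolic powers without fractions\<close>

lemma (in cring) multiplicative_set_compl:
  assumes "primeideal P R"
  shows "multiplicative_set R (carrier R - P)"
proof -
  interpret P: primeideal P R by fact
  show ?thesis
  proof
    show "\<one> \<in> carrier R - P" using P.I_notcarr P.one_imp_carrier by auto
  qed (use P.I_prime in auto)
qed

text \<open>This eliminates the localization: from here on, membership in a contracted ideal is
  witnessed by one denominator \<open>s\<close> outside \<open>P\<close>.\<close>

lemma (in cring) localize_contract_iff:
  assumes "primeideal P R" "ideal J R"
  shows "r \<in> localize_contract R P J \<longleftrightarrow> r \<in> carrier R \<and> (\<exists>s\<in>carrier R - P. s \<otimes> r \<in> J)"
proof -
  interpret multiplicative_set R "carrier R - P" by (rule multiplicative_set_compl) fact
  show ?thesis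
    using fraction_in_extended_ideal_iff[OF assms(2)]
    by (auto simp: localize_contract_def localization_at_def to_localization_at_def[abs_def])
qed

lemma (in cring) ideal_pow:
  assumes "ideal I R"
  shows "ideal (I [^]\<^bsub>ideals_set R\<^esub> (n::nat)) R"
  by (induction n) (auto simp: nat_pow_def ideals_set_def oneideal ideal_prod_is_ideal assms)

lemma (in cring) ideal_pow_simps:
  "I [^]\<^bsub>ideals_set R\<^esub> Suc n = ideal_prod R (I [^]\<^bsub>ideals_set R\<^esub> n) I"
  "\<one>\<^bsub>ideals_set R\<^esub> = carrier R"
  by (auto simp: nat_pow_def ideals_set_def)

lemma (in cring) ideal_pow_mult:
  assumes I: "ideal I R" and "x \<in> I [^]\<^bsub>ideals_set R\<^esub> (m::nat)" "y \<in> I [^]\<^bsub>ideals_set R\<^esub> (n::nat)"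
  shows "x \<otimes> y \<in> I [^]\<^bsub>ideals_set R\<^esub> (m + n)"
proof -
  note ip = ideal_pow[OF I] 
  have car: "x \<in> carrier R" if "x \<in> I [^]\<^bsub>ideals_set R\<^esub> (n::nat)" for x n
    using ideal.Icarr[OF ip] that by blast
  from assms(3) show ?thesis
  proof (induction n arbitrary: y)
    case 0
    then show ?case using assms(2) by (simp add: ideal_pow_simps(2) ideal.I_r_closed[OF ip])
  next
    case (Suc n)
    interpret I: ideal I R by fact
    have "y \<in> ideal_prod R (I [^]\<^bsub>ideals_set R\<^esub> n) I" using Suc.prems unfolding ideal_pow_simps .
    \<comment> \<open>The claim carries \<open>y \<in> carrier R\<close> along because the sum case
      of the induction needs it for distributivity.\<close>
    then have "x \<otimes> y \<in> ideal_prod R (I [^]\<^bsub>ideals_set R\<^esub> (m + n)) I \<and> y \<in> carrier R"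
    proof (induction rule: ideal_prod.induct)
      case (prod i j)
      have "x \<otimes> (i \<otimes> j) = (x \<otimes> i) \<otimes> j"
        using car[OF assms(2)] car[OF prod(1)] I.Icarr[OF prod(2)] by (simp add: m_assoc)
      then show ?case using ideal_prod.prod[OF Suc.IH[OF prod(1)] prod(2)] car[OF prod(1)] I.Icarr[OF prod(2)]
        by simp
    next
      case (sum a b)
      then show ?case using car[OF assms(2)] by (simp add: r_distr ideal_prod.sum)
    qed
    then show ?case unfolding add_Suc_right ideal_pow_simps(1) by blast
  qed
qed

text \<open>The case \<open>n = 0\<close>, treated separately in the definition, fits the same
  formula, since the zeroth power of \<open>I\<close> is \<open>R\<close> and the complement of a
  prime contains 1. For the unit ideal the quantifier over minimal primes is empty.\<close>

lemma (in cring) symbolic_power_iff: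
  assumes I: "ideal I R"
  shows "r \<in> symbolic_power R I n \<longleftrightarrow> r \<in> carrier R \<and>
    (\<forall>P\<in>minimal_primes R I. \<exists>s\<in>carrier R - P. s \<otimes> r \<in> I [^]\<^bsub>ideals_set R\<^esub> n)"
proof (cases "n = 0")
  case True
  have "\<exists>s\<in>carrier R - P. True" if "P \<in> minimal_primes R I" for P
    using multiplicative_set.S_one[OF multiplicative_set_compl[of P]] that
    by (auto simp: minimal_primes_def)
  moreover have "s \<otimes> r \<in> I [^]\<^bsub>ideals_set R\<^esub> n" if "r \<in> carrier R" "s \<in> carrier R" for r s
    using that True by (simp add: ideal_pow_simps)
  ultimately show ?thesis using True unfolding symbolic_power_def by (metis DiffD1)
next
  case False
  have "r \<in> localize_contract R P (I [^]\<^bsub>ideals_set R\<^esub> n) \<longleftrightarrow>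
      r \<in> carrier R \<and> (\<exists>s\<in>carrier R - P. s \<otimes> r \<in> I [^]\<^bsub>ideals_set R\<^esub> n)"
    if "P \<in> minimal_primes R I" for P
    using that by (intro localize_contract_iff ideal_pow I) (auto simp: minimal_primes_def)
  then show ?thesis using False by (auto simp: symbolic_power_def)
qed

text \<open>Denominators \<open>s\<close> for \<open>x\<close> and \<open>t\<close> for
  \<open>y\<close> give the denominator \<open>s t\<close> for the product, again outside the
  prime.\<close>

lemma (in cring) symbolic_power_mult:
  assumes I: "ideal I R" and x: "x \<in> symbolic_power R I m" and y: "y \<in> symbolic_power R I n"
  shows "x \<otimes> y \<in> symbolic_power R I (m + n)"
  unfolding symbolic_power_iff[OF I]
proof (intro conjI ballI)
  have car: "x \<in> carrier R" "y \<in> carrier R"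
    using x y unfolding symbolic_power_iff[OF I] by auto
  then show "x \<otimes> y \<in> carrier R" by simp
  fix P assume P: "P \<in> minimal_primes R I"
  then interpret multiplicative_set R "carrier R - P"
    by (intro multiplicative_set_compl) (simp add: minimal_primes_def)
  obtain s where s: "s \<in> carrier R - P" "s \<otimes> x \<in> I [^]\<^bsub>ideals_set R\<^esub> m"
    using x P unfolding symbolic_power_iff[OF I] by blast
  obtain t where t: "t \<in> carrier R - P" "t \<otimes> y \<in> I [^]\<^bsub>ideals_set R\<^esub> n"
    using y P unfolding symbolic_power_iff[OF I] by blast
  have "(s \<otimes> x) \<otimes> (t \<otimes> y) \<in> I [^]\<^bsub>ideals_set R\<^esub> (m + n)"
    using I s(2) t(2) by (rule ideal_pow_mult)
  also have "(s \<otimes> x) \<otimes> (t \<otimes> y) = (s \<otimes> t) \<otimes> (x \<otimes> y)"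
    using s(1) t(1) car by (simp add: m_ac)
  finally show "\<exists>s\<in>carrier R - P. s \<otimes> (x \<otimes> y) \<in> I [^]\<^bsub>ideals_set R\<^esub> (m + n)"
    using S_mult[OF s(1) t(1)] by blast
qed

lemma (in cring) symbolic_power_Suc_subset:
  assumes I: "ideal I R"
  shows "symbolic_power R I (Suc n) \<subseteq> symbolic_power R I n"
proof -
  have "I [^]\<^bsub>ideals_set R\<^esub> Suc n \<subseteq> I [^]\<^bsub>ideals_set R\<^esub> n"
    using ideal_prod_inter[OF ideal_pow[OF I] I] unfolding ideal_pow_simps by blast
  then show ?thesis by (auto simp only: symbolic_power_iff[OF I] subset_iff) blast
qed

text \<open>Denominators multiply for sums as well. Absorption of ring elements is the case
  \<open>m = 0\<close> of \<open>symbolic_power_mult\<close>, and negation is multiplication by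
  -1.\<close>

lemma (in cring) ideal_symbolic_power:
  assumes I: "ideal I R"
  shows "ideal (symbolic_power R I n) R"
proof (rule idealI)
  note ip = ideal_pow[OF I, of n]
  let ?J = "I [^]\<^bsub>ideals_set R\<^esub> n"
  interpret J: ideal ?J R by (rule ip)
  have mult: "x \<otimes> y \<in> symbolic_power R I n" if "x \<in> carrier R" "y \<in> symbolic_power R I n" for x y
    using symbolic_power_mult[OF I, of x 0 y n] that by (simp add: symbolic_power_def)
  have car: "x \<in> carrier R" if "x \<in> symbolic_power R I n" for x
    using that unfolding symbolic_power_iff[OF I] by auto
  show "subgroup (symbolic_power R I n) (add_monoid R)"
  proof (rule subgroup.intro, simp_all only: partial_object.select_convs monoid.select_convs)
    show "symbolic_power R I n \<subseteq> carrier R" using car by blast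
    have "\<one> \<in> carrier R - P" if "P \<in> minimal_primes R I" for P
      using multiplicative_set.S_one[OF multiplicative_set_compl[of P]] that
      by (auto simp: minimal_primes_def)
    moreover have "\<one> \<otimes> \<zero> \<in> ?J" by simp
    ultimately show "\<zero> \<in> symbolic_power R I n"
      unfolding symbolic_power_iff[OF I] by blast
  next
    fix x y assume xy: "x \<in> symbolic_power R I n" "y \<in> symbolic_power R I n"
    show "x \<oplus> y \<in> symbolic_power R I n"
      unfolding symbolic_power_iff[OF I]
    proof (intro conjI ballI)
      show "x \<oplus> y \<in> carrier R" using car xy by simp
      fix P assume P: "P \<in> minimal_primes R I"
      then interpret multiplicative_set R "carrier R - P"
        by (intro multiplicative_set_compl) (simp add: minimal_primes_def)
      obtain s where s: "s \<in> carrier R - P" "s \<otimes> x \<in> ?J"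
        using xy(1) P unfolding symbolic_power_iff[OF I] by blast
      obtain t where t: "t \<in> carrier R - P" "t \<otimes> y \<in> ?J"
        using xy(2) P unfolding symbolic_power_iff[OF I] by blast
      have "t \<otimes> (s \<otimes> x) \<oplus> s \<otimes> (t \<otimes> y) \<in> ?J"
        using s(1) t(1) by (intro J.a_closed J.I_l_closed[OF s(2)] J.I_l_closed[OF t(2)]) auto
      also have "t \<otimes> (s \<otimes> x) \<oplus> s \<otimes> (t \<otimes> y) = (s \<otimes> t) \<otimes> (x \<oplus> y)"
        using s(1) t(1) car[OF xy(1)] car[OF xy(2)] by (simp add: m_ac r_distr)
      finally show "\<exists>s\<in>carrier R - P. s \<otimes> (x \<oplus> y) \<in> ?J"
        using S_mult[OF s(1) t(1)] by blast
    qed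
  next
    fix x assume x: "x \<in> symbolic_power R I n"
    then show "inv\<^bsub>add_monoid R\<^esub> x \<in> symbolic_power R I n"
      using mult[of "\<ominus> \<one>" x] car[OF x] by (simp add: l_minus a_inv_def[symmetric])
  qed
  show "x \<otimes> a \<in> symbolic_power R I n" "a \<otimes> x \<in> symbolic_power R I n"
    if "a \<in> symbolic_power R I n" "x \<in> carrier R" for a x
    using mult[OF that(2,1)] m_comm[OF that(2) car[OF that(1)]] by simp_all
qed (rule ring_axioms)

section \<open>The Frobenius splitting of a polynomial ring\<close>

type_synonym 'k mpoly = "(nat \<Rightarrow>\<^sub>0 nat) \<Rightarrow>\<^sub>0 'k"

section \<open>Termwise induction and the characteristic of polynomial rings\<close>

lemma update_eq_add_single:
  fixes f :: "'a \<Rightarrow>\<^sub>0 'b::monoid_add"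
  assumes "k \<notin> Poly_Mapping.keys f"
  shows "Poly_Mapping.update k v f = f + Poly_Mapping.single k v"
  using assms by (intro poly_mapping_eqI) (auto simp: lookup_update lookup_add lookup_single in_keys_iff)

text \<open>Only terms that occur in \<open>f\<close> have to be checked, so conditions on the
  monomials of \<open>f\<close> remain available.\<close>

lemma poly_mapping_term_induct [case_names zero "term" add]:
  fixes f :: "'a \<Rightarrow>\<^sub>0 'b::monoid_add"
  assumes zero: "P 0"
    and "term": "\<And>k. k \<in> Poly_Mapping.keys f \<Longrightarrow> P (Poly_Mapping.single k (Poly_Mapping.lookup f k))"
    and add: "\<And>g h. P g \<Longrightarrow> P h \<Longrightarrow> P (g + h)"
  shows "P f"
  using "term"
proof (induction f rule: update_induct)
  case (update f a b)
  have "P (Poly_Mapping.single k (Poly_Mapping.lookup f k))" if "k \<in> Poly_Mapping.keys f" for k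
    using update.prems[of k] update.hyps that by (auto simp: lookup_update keys_update split: if_splits)
  then have "P f" by (rule update.IH)
  moreover have "P (Poly_Mapping.single a b)"
    using update.prems[of a] update.hyps by (auto simp: lookup_update keys_update)
  ultimately show ?case by (simp add: update_eq_add_single update.hyps add)
qed (rule zero)

lemma poly_mapping_add_induct [case_names zero single add]:
  fixes f :: "'a \<Rightarrow>\<^sub>0 'b::monoid_add"
  assumes "P 0" "\<And>k v. P (Poly_Mapping.single k v)" "\<And>g h. P g \<Longrightarrow> P h \<Longrightarrow> P (g + h)"
  shows "P f"
  using assms by (rule poly_mapping_term_induct)

text \<open>Natural numbers embed as constants, so they vanish exactly when they vanish in the
  coefficients. This makes freshman's dream available for polynomials.\<close>

lemma CHAR_poly_mapping: "CHAR('a::monoid_add \<Rightarrow>\<^sub>0 'b::semiring_1) = CHAR('b)"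
proof (rule CHAR_eqI)
  have *: "(of_nat n :: 'a \<Rightarrow>\<^sub>0 'b) = 0 \<longleftrightarrow> (of_nat n :: 'b) = 0" for n
  proof -
    have "Poly_Mapping.single (0::'a) x = 0 \<longleftrightarrow> x = 0" for x :: 'b
      by transfer (auto simp: fun_eq_iff when_def)
    then show ?thesis by (simp only: single_of_nat[symmetric])
  qed
  show "of_nat CHAR('b) = (0 :: 'a \<Rightarrow>\<^sub>0 'b)" by (simp add: *)
  show "CHAR('b) dvd n" if "of_nat n = (0 :: 'a \<Rightarrow>\<^sub>0 'b)" for n
    using that by (simp add: * of_nat_eq_0_iff_char_dvd)
qed

section \<open>The splitting map on polynomials\<close>

definition scale_exponents :: "nat \<Rightarrow> (nat \<Rightarrow>\<^sub>0 nat) \<Rightarrow> nat \<Rightarrow>\<^sub>0 nat"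
  where "scale_exponents n e = Poly_Mapping.map ((*) n) e"

lemma lookup_scale_exponents [simp]:
  "Poly_Mapping.lookup (scale_exponents n e) i = n * Poly_Mapping.lookup e i"
  by (simp add: scale_exponents_def map.rep_eq when_def)

lemma scale_exponents_add: "scale_exponents n (e + f) = scale_exponents n e + scale_exponents n f"
  by (intro poly_mapping_eqI) (simp add: lookup_add algebra_simps)

lemma scale_exponents_Suc: "scale_exponents (Suc n) e = e + scale_exponents n e"
  by (intro poly_mapping_eqI) (simp add: lookup_add)

lemma scale_exponents_0: "scale_exponents 0 e = 0" "scale_exponents n 0 = 0"
  by (intro poly_mapping_eqI; simp)+

lemma inj_scale_exponents: "n > 0 \<Longrightarrow> inj (scale_exponents n)"
  by (intro injI poly_mapping_eqI) (metis lookup_scale_exponents mult_left_cancel neq0_conv)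

text \<open>Adding a vector divisible by \<open>n\<close> neither creates nor destroys divisibility
  by \<open>n\<close>; hence multiplying by the \<open>p\<close>-th power of a monomial does not
  move an exponent into or out of the set that the splitting keeps.\<close>

lemma scale_exponents_add_eq_iff:
  assumes "n > 0"
  shows "(\<exists>v. scale_exponents n e + u = scale_exponents n v) \<longleftrightarrow> (\<exists>v. u = scale_exponents n v)"
proof
  assume "\<exists>v. scale_exponents n e + u = scale_exponents n v"
  then obtain v where v: "scale_exponents n e + u = scale_exponents n v" by blast
  \<comment> \<open>Subtraction is truncated, but \<open>v\<close> dominates this entry of
    \<open>n\<close> times \<open>e\<close> after scaling by \<open>n\<close>, so nothing is
    lost.\<close>
  have "Poly_Mapping.lookup u i = n * (Poly_Mapping.lookup v i - Poly_Mapping.lookup e i)" for i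
    using arg_cong[OF v, of "\<lambda>z. Poly_Mapping.lookup z i"] by (simp add: lookup_add diff_mult_distrib2)
  then have "u = scale_exponents n (v - e)"
    by (intro poly_mapping_eqI) (simp add: lookup_minus)
  then show "\<exists>v. u = scale_exponents n v" ..
qed (metis scale_exponents_add)

lemma single_power:
  "Poly_Mapping.single e c ^ n = Poly_Mapping.single (scale_exponents n e) (c ^ n :: 'k::comm_semiring_1)"
  by (induction n) (simp_all add: scale_exponents_0 scale_exponents_Suc mult_single)

text \<open>The \<open>p\<close>-th root. \<open>inv_into\<close> is a two-sided inverse because
  Frobenius is bijective on a perfect field of prime characteristic, the setting of the context
  below.\<close>

definition frobenius_root :: "'k::field \<Rightarrow> 'k"
  where "frobenius_root = inv_into UNIV (\<lambda>x. x ^ CHAR('k))"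

text \<open>The map \<Phi> of the overview: \<open>map_key\<close> reads off the coefficients at
  exponents divisible by \<open>p\<close>, and then the roots of these coefficients are
  taken.\<close>

definition frobenius_split :: "'k::field mpoly \<Rightarrow> 'k mpoly"
  where "frobenius_split f =
    Poly_Mapping.map frobenius_root (Poly_Mapping.map_key (scale_exponents CHAR('k)) f)"

context
  assumes prime_char: "Factorial_Ring.prime CHAR('k::field)" and perfect: "perfect_field TYPE('k)"
begin

lemma char_pos: "CHAR('k) > 0"
  using prime_char prime_gt_0_nat by blast

lemma frobenius_add: "(x + y :: 'k) ^ CHAR('k) = x ^ CHAR('k) + y ^ CHAR('k)"
  using prime_char by (intro freshmans_dream) auto

text \<open>Surjectivity is perfectness, as positive characteristic rules out the other alternative
  in its definition. For injectivity, equal powers give \<open>(x - y) ^ p = 0\<close> in a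
  field.\<close>

lemma frobenius_bij: "bij (\<lambda>x::'k. x ^ CHAR('k))"
proof (rule bijI)
  show "surj (\<lambda>x::'k. x ^ CHAR('k))"
    using perfect char_pos by (simp add: perfect_field_def)
  show "inj (\<lambda>x::'k. x ^ CHAR('k))"
  proof (rule injI)
    fix x y :: 'k assume "x ^ CHAR('k) = y ^ CHAR('k)"
    then have "(x - y) ^ CHAR('k) = 0"
      using frobenius_add[of "x - y" y] by simp
    then show "x = y" by simp
  qed
qed

text \<open>Both identities are checked after raising to the \<open>p\<close>-th power, which is
  injective.\<close>

lemma frobenius_root_power: "frobenius_root (x ^ CHAR('k) * y) = x * frobenius_root (y :: 'k)"
  and frobenius_root_add: "frobenius_root (x + y) = frobenius_root x + frobenius_root (y :: 'k)"
proof -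
  have root: "frobenius_root z ^ CHAR('k) = z" for z :: 'k
    unfolding frobenius_root_def using frobenius_bij by (meson bij_inv_eq_iff)
  have eqI: "a = b" if "a ^ CHAR('k) = b ^ CHAR('k)" for a b :: 'k
    using injD[OF bij_is_inj[OF frobenius_bij]] that by blast
  show "frobenius_root (x ^ CHAR('k) * y) = x * frobenius_root y"
    by (rule eqI) (simp add: root power_mult_distrib)
  show "frobenius_root (x + y) = frobenius_root x + frobenius_root y"
    by (rule eqI) (simp add: root frobenius_add)
qed

lemma frobenius_root_0: "frobenius_root (0::'k) = 0"
  using frobenius_root_power[of 0 0] char_pos by simp

lemma frobenius_root_1: "frobenius_root (1::'k) = 1"
  using frobenius_root_power[of 1 1] frobenius_root_power[of "frobenius_root 1" 1] char_pos
    bij_inv_eq_iff[OF frobenius_bij, of 1 1]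
  by (simp add: frobenius_root_def)

text \<open>\<open>Poly_Mapping.map\<close> keeps zero coefficients at zero; the formula is uniform
  because the root of 0 is 0.\<close>

lemma lookup_frobenius_split:
  "Poly_Mapping.lookup (frobenius_split f) e =
    frobenius_root (Poly_Mapping.lookup (f :: 'k mpoly) (scale_exponents CHAR('k) e))"
  by (simp add: frobenius_split_def map.rep_eq map_key.rep_eq[OF inj_scale_exponents[OF char_pos]]
      when_def frobenius_root_0)

lemma keys_frobenius_split:
  "e \<in> Poly_Mapping.keys (frobenius_split f) \<Longrightarrow>
    scale_exponents CHAR('k) e \<in> Poly_Mapping.keys (f :: 'k mpoly)"
  by (auto simp: in_keys_iff lookup_frobenius_split frobenius_root_0)

lemma frobenius_split_add: "frobenius_split (f + g) = frobenius_split f + frobenius_split (g :: 'k mpoly)"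
  by (intro poly_mapping_eqI) (simp add: lookup_frobenius_split lookup_add frobenius_root_add)

lemma frobenius_split_0: "frobenius_split (0 :: 'k mpoly) = 0"
  by (intro poly_mapping_eqI) (simp add: lookup_frobenius_split frobenius_root_0)

lemma frobenius_split_single:
  "frobenius_split (Poly_Mapping.single (scale_exponents CHAR('k) e) (c :: 'k)) =
    Poly_Mapping.single e (frobenius_root c)"
  using inj_eq[OF inj_scale_exponents[OF char_pos]]
  by (intro poly_mapping_eqI) (simp add: lookup_frobenius_split lookup_single when_def frobenius_root_0)

lemma frobenius_split_single_eq_0:
  "\<nexists>v. u = scale_exponents CHAR('k) v \<Longrightarrow> frobenius_split (Poly_Mapping.single u (c :: 'k)) = 0"
  by (intro poly_mapping_eqI) (auto simp: lookup_frobenius_split lookup_single when_def frobenius_root_0)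

lemma frobenius_split_1: "frobenius_split (1 :: 'k mpoly) = 1"
  using frobenius_split_single[of 0 1] by (simp add: scale_exponents_0 frobenius_root_1)

text \<open>Both sides are additive in \<open>f\<close>, by freshman's dream, and in
  \<open>g\<close>, so single terms suffice. There either the exponent of \<open>g\<close> is
  \<open>p\<close> times a vector and the law for roots applies, or both sides vanish.\<close>

lemma frobenius_split_power_mult:
  "frobenius_split (f ^ CHAR('k) * g) = f * frobenius_split (g :: 'k mpoly)"
proof (induction f rule: poly_mapping_add_induct)
  case zero
  then show ?case using char_pos by (simp add: frobenius_split_0 zero_power)
next
  case (single e c)
  show ?case
  proof (induction g rule: poly_mapping_add_induct)
    case (single u v)
    have *: "Poly_Mapping.single e c ^ CHAR('k) * Poly_Mapping.single u v =
        Poly_Mapping.single (scale_exponents CHAR('k) e + u) (c ^ CHAR('k) * v)"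
      by (simp add: single_power mult_single)
    show ?case
    proof (cases "\<exists>w. u = scale_exponents CHAR('k) w")
      case True
      then obtain w where "u = scale_exponents CHAR('k) w" by blast
      then show ?thesis unfolding *
        by (simp add: scale_exponents_add[symmetric] frobenius_split_single frobenius_root_power mult_single)
    next
      case False
      then show ?thesis unfolding *
        using scale_exponents_add_eq_iff[OF char_pos, of e u]
        by (simp add: frobenius_split_single_eq_0)
    qed
  qed (simp_all add: frobenius_split_0 frobenius_split_add algebra_simps)
next
  case (add f h)
  have "(f + h) ^ CHAR('k) = f ^ CHAR('k) + h ^ CHAR('k)"
    by (intro freshmans_dream) (simp_all add: CHAR_poly_mapping prime_char)
  then show ?case using add by (simp add: algebra_simps frobenius_split_add)
qed

end

section \<open>Square-free monomial ideals\<close>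

lemma mpoly_ring_simps [simp]:
  "carrier (mpoly_ring d) = {f. Poly_Mapping.keys f \<subseteq> exponents d}"
  "f \<otimes>\<^bsub>mpoly_ring d\<^esub> g = f * g" "f \<oplus>\<^bsub>mpoly_ring d\<^esub> g = f + g"
  "\<one>\<^bsub>mpoly_ring d\<^esub> = 1" "\<zero>\<^bsub>mpoly_ring d\<^esub> = 0"
  by (simp_all add: mpoly_ring_def ring_of_type_algebra_def)

lemma exponents_iff: "e \<in> exponents d \<longleftrightarrow> (\<forall>i\<ge>d. Poly_Mapping.lookup e i = 0)"
  by (auto simp: exponents_def in_keys_iff not_less[symmetric])

lemma exponents_add: "e + f \<in> exponents d \<longleftrightarrow> e \<in> exponents d \<and> f \<in> exponents d"
  by (auto simp: exponents_iff lookup_add)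

lemma single_exponents: "j < d \<Longrightarrow> Poly_Mapping.single j n \<in> exponents d"
  by (auto simp: exponents_iff lookup_single when_def)

lemma keys_mult_cases:
  assumes "e \<in> Poly_Mapping.keys (f * g)"
  obtains a b where "a \<in> Poly_Mapping.keys f" "b \<in> Poly_Mapping.keys g" "e = a + b"
  using keys_mult[of f g] assms by blast

lemma keys_add_cases:
  assumes "e \<in> Poly_Mapping.keys (f + g)"
  obtains "e \<in> Poly_Mapping.keys f" | "e \<in> Poly_Mapping.keys g"
  using keys_add[of f g] assms by blast

lemma mpoly_ring_closed:
  fixes f g :: "'k::field mpoly"
  shows "1 \<in> carrier (mpoly_ring d :: 'k mpoly ring)"
    and "f \<in> carrier (mpoly_ring d) \<Longrightarrow> g \<in> carrier (mpoly_ring d) \<Longrightarrow> f + g \<in> carrier (mpoly_ring d)"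
    and "f \<in> carrier (mpoly_ring d) \<Longrightarrow> g \<in> carrier (mpoly_ring d) \<Longrightarrow> f * g \<in> carrier (mpoly_ring d)"
    and "f \<in> carrier (mpoly_ring d) \<Longrightarrow> - f \<in> carrier (mpoly_ring d)"
  by (auto simp: exponents_add in_keys_iff[of _ "- f"] elim!: keys_mult_cases keys_add_cases)
    (auto simp: exponents_iff)

lemma cring_mpoly_ring: "cring (mpoly_ring d :: 'k::field mpoly ring)"
  by (rule cring_surjective_image[where h = "\<lambda>f. f" and B = "carrier (mpoly_ring d)"])
    (fact mpoly_ring_closed | simp)+

section \<open>Ideals generated by variables, their powers and primality\<close>

definition partial_degree :: "nat set \<Rightarrow> (nat \<Rightarrow>\<^sub>0 nat) \<Rightarrow> nat"
  where "partial_degree C e = (\<Sum>j\<in>C. Poly_Mapping.lookup e j)"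

lemma partial_degree_add: "partial_degree C (e + f) = partial_degree C e + partial_degree C f"
  by (simp add: partial_degree_def lookup_add sum.distrib)

lemma partial_degree_scale: "partial_degree C (scale_exponents n e) = n * partial_degree C e"
  by (simp add: partial_degree_def sum_distrib_left)

lemma partial_degree_pos_iff:
  "finite C \<Longrightarrow> partial_degree C e \<ge> 1 \<longleftrightarrow> (\<exists>j\<in>C. Poly_Mapping.lookup e j \<ge> 1)"
  by (auto simp: partial_degree_def Suc_le_eq sum_eq_0_iff simp flip: neq0_conv)

text \<open>The \<open>m\<close>-th power of the prime \<open>(x\<^sub>j | j \<in> C)\<close>.\<close>

definition degree_ideal :: "nat \<Rightarrow> nat set \<Rightarrow> nat \<Rightarrow> 'k::field mpoly set"
  where "degree_ideal d C m =
    {f. Poly_Mapping.keys f \<subseteq> exponents d \<and> (\<forall>e\<in>Poly_Mapping.keys f. m \<le> partial_degree C e)}"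

lemma degree_ideal_add:
  "f \<in> degree_ideal d C m \<Longrightarrow> g \<in> degree_ideal d C m \<Longrightarrow> f + g \<in> degree_ideal d C m"
  using keys_add[of f g] by (auto simp: degree_ideal_def)

lemma degree_ideal_mult:
  assumes "f \<in> degree_ideal d C m" "g \<in> degree_ideal d C n"
  shows "f * g \<in> degree_ideal d C (m + n)"
  using assms
  by (auto simp: degree_ideal_def exponents_add partial_degree_add intro!: add_mono elim!: keys_mult_cases)

lemma degree_ideal_0: "degree_ideal d C 0 = carrier (mpoly_ring d)"
  by (simp add: degree_ideal_def)

text \<open>Absorption is \<open>degree_ideal_mult\<close> with bound 0 on the other factor, as
  \<open>degree_ideal d C 0\<close> is the whole ring.\<close>

lemma ideal_degree_ideal: "ideal (degree_ideal d C m :: 'k::field mpoly set) (mpoly_ring d)"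
proof -
  interpret cring "mpoly_ring d :: 'k mpoly ring" by (rule cring_mpoly_ring)
  have carrier: "degree_ideal d C m \<subseteq> carrier (mpoly_ring d :: 'k mpoly ring)"
    by (auto simp: degree_ideal_def)
  have mult: "f * g \<in> degree_ideal d C m"
    if "f \<in> carrier (mpoly_ring d)" "g \<in> degree_ideal d C m" for f g :: "'k mpoly"
    using degree_ideal_mult[of f d C 0 g m] that by (simp add: degree_ideal_0)
  have mult': "g * f \<in> degree_ideal d C m"
    if "f \<in> carrier (mpoly_ring d)" "g \<in> degree_ideal d C m" for f g :: "'k mpoly"
    using mult[OF that] by (simp add: mult.commute)
  show ?thesis
  proof (rule idealI)
    show "subgroup (degree_ideal d C m) (add_monoid (mpoly_ring d :: 'k mpoly ring))"
    proof (rule add.subgroupI)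
      show "degree_ideal d C m \<subseteq> carrier (mpoly_ring d :: 'k mpoly ring)" by (rule carrier)
      have "0 \<in> degree_ideal d C m" by (simp add: degree_ideal_def)
      then show "degree_ideal d C m \<noteq> ({} :: 'k mpoly set)" by blast
      show "\<ominus>\<^bsub>mpoly_ring d\<^esub> f \<in> degree_ideal d C m" if "f \<in> degree_ideal d C m" for f :: "'k mpoly"
      proof -
        have minus: "- f \<in> degree_ideal d C m"
          using that by (auto simp: degree_ideal_def in_keys_iff)
        have "\<ominus>\<^bsub>mpoly_ring d\<^esub> f = - f"
          by (rule minus_equality) (use that minus carrier in auto)
        then show ?thesis using minus by simp
      qed
    qed (simp add: degree_ideal_add)
  qed (use mult mult' in \<open>auto intro: ring_axioms\<close>)
qed

lemma mem_ideal_of_terms: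
  assumes "ideal J (mpoly_ring d :: 'k::field mpoly ring)"
    and "\<And>e. e \<in> Poly_Mapping.keys f \<Longrightarrow> Poly_Mapping.single e (Poly_Mapping.lookup f e) \<in> J"
  shows "f \<in> J"
proof -
  interpret R: cring "mpoly_ring d :: 'k mpoly ring" by (rule cring_mpoly_ring)
  interpret J: ideal J "mpoly_ring d :: 'k mpoly ring" by fact
  show ?thesis
    by (rule poly_mapping_term_induct[where P = "\<lambda>g. g \<in> J"])
      (use assms(2) J.zero_closed J.a_closed in auto)
qed

text \<open>Let \<open>T f\<close> be \<open>f\<close> without its monomials of positive degree in
  \<open>C\<close>; it is congruent to \<open>f\<close>. If \<open>f * g\<close> lies in the ideal,
  so does \<open>T f * T g\<close>, but all monomials of this product have degree 0 in
  \<open>C\<close>, so it is zero and one factor vanishes.\<close>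

lemma primeideal_degree_ideal: "primeideal (degree_ideal d C 1 :: 'k::field mpoly set) (mpoly_ring d)"
proof (rule primeidealI)
  let ?Q = "degree_ideal d C 1 :: 'k mpoly set"
  show ideal: "ideal ?Q (mpoly_ring d)" by (rule ideal_degree_ideal)
  show "cring (mpoly_ring d :: 'k mpoly ring)" by (rule cring_mpoly_ring)
  have "1 \<notin> ?Q" by (simp add: degree_ideal_def partial_degree_def)
  then show "carrier (mpoly_ring d) \<noteq> ?Q" using mpoly_ring_closed(1) by blast
  define T :: "'k mpoly \<Rightarrow> 'k mpoly" where "T = Poly_Mapping.mapp (\<lambda>e c. if partial_degree C e = 0 then c else 0)"
  have T_lookup: "Poly_Mapping.lookup (T f) e = (if partial_degree C e = 0 then Poly_Mapping.lookup f e else 0)" for f e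
    by (simp add: T_def lookup_mapp when_def in_keys_iff)
  have T_keys: "e \<in> Poly_Mapping.keys (T f) \<longleftrightarrow> e \<in> Poly_Mapping.keys f \<and> partial_degree C e = 0" for e f
    by (auto simp: in_keys_iff T_lookup)
  have rest: "f - T f \<in> ?Q" if "f \<in> carrier (mpoly_ring d)" for f
    using that by (auto simp: degree_ideal_def in_keys_iff lookup_minus T_lookup Suc_le_eq split: if_splits)
  have T_carrier: "T f \<in> carrier (mpoly_ring d)" if "f \<in> carrier (mpoly_ring d)" for f
    using that by (auto simp: T_keys)
  fix f g :: "'k mpoly"
  assume f: "f \<in> carrier (mpoly_ring d)" and g: "g \<in> carrier (mpoly_ring d)"
    and fg: "f \<otimes>\<^bsub>mpoly_ring d\<^esub> g \<in> ?Q"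
  have mult: "u * v \<in> ?Q" if "u \<in> carrier (mpoly_ring d)" "v \<in> ?Q" for u v
    using degree_ideal_mult[of u d C 0 v 1] that by (simp add: degree_ideal_0)
  have "- T f * (g - T g) \<in> ?Q" "- g * (f - T f) \<in> ?Q"
    by (rule mult mpoly_ring_closed(4) T_carrier rest f g)+
  with fg have "f * g + (- T f * (g - T g) + - g * (f - T f)) \<in> ?Q"
    by (simp only: degree_ideal_add mpoly_ring_simps)
  also have "f * g + (- T f * (g - T g) + - g * (f - T f)) = T f * T g"
    by (simp add: algebra_simps)
  finally have Q: "T f * T g \<in> ?Q" .
  have "Poly_Mapping.keys (T f * T g) = {}"
  proof (rule equals0I)
    fix e assume e: "e \<in> Poly_Mapping.keys (T f * T g)"
    then have "partial_degree C e = 0"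
      by (rule keys_mult_cases) (simp add: T_keys partial_degree_add)
    then show False using Q e by (auto simp: degree_ideal_def)
  qed
  then have "T f = 0 \<or> T g = 0" by simp
  moreover have "f \<in> ?Q" if "T f = 0" using rest[OF f] that by simp
  moreover have "g \<in> ?Q" if "T g = 0" using rest[OF g] that by simp
  ultimately show "f \<in> ?Q \<or> g \<in> ?Q" by blast
qed

text \<open>A monomial \<open>e\<close> of the image comes from \<open>p e\<close> in
  \<open>f\<close>, so \<open>m \<le> p * partial_degree C e\<close>. Hypothesis \<open>mn\<close>
  says that \<open>n\<close> is at most \<open>m / p\<close> rounded up; this form covers both pairs
  used later, \<open>(p n, n)\<close> and \<open>(p n + 1, n + 1)\<close>.\<close>

lemma degree_ideal_frobenius_split:
  assumes p: "Factorial_Ring.prime CHAR('k::field)" "perfect_field TYPE('k)"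
    and mn: "\<And>k. m \<le> CHAR('k) * k \<Longrightarrow> n \<le> k"
    and f: "(f :: 'k mpoly) \<in> degree_ideal d C m"
  shows "frobenius_split f \<in> degree_ideal d C n"
  unfolding degree_ideal_def
proof (intro CollectI conjI ballI subsetI)
  fix e assume "e \<in> Poly_Mapping.keys (frobenius_split f)"
  then have e: "scale_exponents CHAR('k) e \<in> Poly_Mapping.keys f"
    by (rule keys_frobenius_split[OF p])
  then have "m \<le> CHAR('k) * partial_degree C e" "scale_exponents CHAR('k) e \<in> exponents d"
    using f by (auto simp: degree_ideal_def partial_degree_scale[symmetric])
  then show "n \<le> partial_degree C e" "e \<in> exponents d"
    using mn char_pos[OF p] by (auto simp: exponents_iff)
qed

abbreviation variable :: "nat \<Rightarrow> 'k::field mpoly"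
  where "variable j \<equiv> monomial (Poly_Mapping.single j 1)"

lemma monomial_add: "monomial (e + f) = monomial e * monomial f"
  by (simp add: monomial_def mult_single)

lemma monomial_0: "monomial 0 = 1"
  by (simp add: monomial_def)

lemma keys_monomial: "Poly_Mapping.keys (monomial e :: 'k::field mpoly) = {e}"
  by (simp add: monomial_def)

lemma single_eq_add_single:
  assumes "Poly_Mapping.lookup e j \<ge> 1"
  obtains e' :: "nat \<Rightarrow>\<^sub>0 nat" where "e = Poly_Mapping.single j 1 + e'"
proof
  show "e = Poly_Mapping.single j 1 + (e - Poly_Mapping.single j 1)"
    using assms
    by (intro poly_mapping_eqI) (auto simp: lookup_add lookup_minus lookup_single when_def)
qed

text \<open>Otherwise primality, applied to one variable at a time by induction on the total degree,
  keeps the monomial out of \<open>P\<close>; the induction starts from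
  \<open>1 \<notin> P\<close>.\<close>

lemma monomial_in_primeideal:
  assumes P: "primeideal P (mpoly_ring d :: 'k::field mpoly ring)"
    and e: "e \<in> exponents d" and "monomial e \<in> P"
  shows "\<exists>j<d. Poly_Mapping.lookup e j \<ge> 1 \<and> variable j \<in> P"
proof (rule ccontr)
  assume no: "\<not> ?thesis"
  interpret primeideal P "mpoly_ring d :: 'k mpoly ring" by fact
  have mult: "f * g \<notin> P" if "f \<in> carrier (mpoly_ring d)" "g \<in> carrier (mpoly_ring d)" "f \<notin> P" "g \<notin> P" for f g
    using I_prime[of f g] that by auto
  have one: "1 \<notin> P" using I_notcarr one_imp_carrier by auto
  have "partial_degree {..<d} e = n \<Longrightarrow> e \<in> exponents d \<Longrightarrow>
      \<forall>j<d. Poly_Mapping.lookup e j \<ge> 1 \<longrightarrow> variable j \<notin> P \<Longrightarrow> monomial e \<notin> P" for n e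
  proof (induction n arbitrary: e)
    case 0
    then have "Poly_Mapping.lookup e i = 0" for i
      by (cases "i < d") (auto simp: partial_degree_def exponents_iff)
    then have "e = 0" by (intro poly_mapping_eqI) simp
    then show ?case using one by (simp add: monomial_0)
  next
    case (Suc n)
    then obtain j where j: "j < d" "Poly_Mapping.lookup e j \<ge> 1"
      using partial_degree_pos_iff[of "{..<d}" e] by auto
    from j(2) obtain e' where e': "e = Poly_Mapping.single j 1 + e'" by (rule single_eq_add_single)
    have "partial_degree {..<d} (Poly_Mapping.single j 1) = 1"
      using j by (simp add: partial_degree_def lookup_single when_def)
    then have "partial_degree {..<d} e' = n"
      using Suc.prems(1) by (simp add: e' partial_degree_add)
    moreover have ex: "e' \<in> exponents d" "Poly_Mapping.single j 1 \<in> exponents d"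
      using Suc.prems(2) by (simp_all add: e' exponents_add)
    moreover have "\<forall>i<d. Poly_Mapping.lookup e' i \<ge> 1 \<longrightarrow> variable i \<notin> P"
      using Suc.prems(3) by (auto simp: e' lookup_add)
    ultimately have "monomial e' \<notin> P" using Suc.IH by blast
    then show ?case
      unfolding e' monomial_add using Suc.prems(3) j ex
      by (intro mult) (simp_all add: keys_monomial)
  qed
  with e no \<open>monomial e \<in> P\<close> show False by blast
qed

section \<open>Minimal primes of a square-free monomial ideal\<close>

locale squarefree_ideal =
  fixes d :: nat and E :: "(nat \<Rightarrow>\<^sub>0 nat) set" and I :: "'k::field mpoly set"
  assumes E_exponents: "E \<subseteq> exponents d" and E_squarefree: "\<And>e i. e \<in> E \<Longrightarrow> Poly_Mapping.lookup e i \<le> 1"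
    and I_def: "I = genideal (mpoly_ring d) (monomial ` E)"
begin

abbreviation "R \<equiv> (mpoly_ring d :: 'k mpoly ring)"

sublocale R: cring R by (rule cring_mpoly_ring)

lemma generators_carrier: "monomial ` E \<subseteq> carrier R"
  using E_exponents by (auto simp: keys_monomial)

lemma ideal_I: "ideal I R"
  unfolding I_def by (rule R.genideal_ideal) (rule generators_carrier)

lemma generator_in_I: "e \<in> E \<Longrightarrow> monomial e \<in> I"
  using R.genideal_self[OF generators_carrier] unfolding I_def by blast

lemma I_subset_iff: "ideal J R \<Longrightarrow> I \<subseteq> J \<longleftrightarrow> monomial ` E \<subseteq> J"
  using R.genideal_minimal[of J "monomial ` E"] R.genideal_self[OF generators_carrier]
  unfolding I_def by blast

text \<open>Containment can be tested on generators. The condition says that \<open>C\<close> is a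
  vertex cover of the hypergraph of supports of the generators.\<close>

lemma I_subset_degree_ideal_iff:
  assumes "finite C"
  shows "I \<subseteq> degree_ideal d C 1 \<longleftrightarrow> (\<forall>e\<in>E. \<exists>j\<in>C. Poly_Mapping.lookup e j \<ge> 1)"
  unfolding I_subset_iff[OF ideal_degree_ideal] using E_exponents
  by (auto simp: degree_ideal_def keys_monomial partial_degree_pos_iff[OF assms, simplified] image_subset_iff)

definition vars_of :: "'k mpoly set \<Rightarrow> nat set"
  where "vars_of P = {j. j < d \<and> variable j \<in> P}"

lemma finite_vars_of: "finite (vars_of P)"
  unfolding vars_of_def by simp

context
  fixes P assumes P: "P \<in> minimal_primes R I"
begin

lemma P_prime: "primeideal P R" and I_sub_P: "I \<subseteq> P"
  using P by (auto simp: minimal_primes_def)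

interpretation P: primeideal P R by (rule P_prime)

text \<open>Each generator lies in the prime \<open>P\<close>, hence so does one of its
  variables.\<close>

lemma I_sub_degree_ideal: "I \<subseteq> degree_ideal d (vars_of P) 1"
  unfolding I_subset_degree_ideal_iff[OF finite_vars_of]
proof
  fix e assume "e \<in> E"
  then have "e \<in> exponents d" "monomial e \<in> P"
    using E_exponents generator_in_I I_sub_P by auto
  then show "\<exists>j\<in>vars_of P. Poly_Mapping.lookup e j \<ge> 1"
    using monomial_in_primeideal[OF P_prime] by (fastforce simp: vars_of_def)
qed

lemma degree_ideal_sub_P:
  assumes "C \<subseteq> vars_of P"
  shows "degree_ideal d C 1 \<subseteq> P"
proof
  have C: "finite C" using assms finite_vars_of finite_subset by blast
  fix f :: "'k mpoly" assume f: "f \<in> degree_ideal d C 1"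
  show "f \<in> P"
  proof (rule mem_ideal_of_terms[OF P.is_ideal])
    fix e assume "e \<in> Poly_Mapping.keys f"
    then have e: "e \<in> exponents d" "partial_degree C e \<ge> 1" using f by (auto simp: degree_ideal_def)
    then obtain j where j: "j \<in> C" "Poly_Mapping.lookup e j \<ge> 1"
      unfolding partial_degree_pos_iff[OF C] by blast
    from j(2) obtain e' where e': "e = Poly_Mapping.single j 1 + e'" by (rule single_eq_add_single)
    have "variable j \<otimes>\<^bsub>R\<^esub> Poly_Mapping.single e' (Poly_Mapping.lookup f e) \<in> P"
      using assms j e(1) by (intro P.I_r_closed) (auto simp: vars_of_def e' exponents_add)
    then show "Poly_Mapping.single e (Poly_Mapping.lookup f e) \<in> P"
      by (simp add: monomial_def mult_single e')
  qed
qed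

text \<open>If every generator involved a variable of \<open>C\<close> other than
  \<open>x\<^sub>j\<close>, the remaining variables would generate a prime containing
  \<open>I\<close> and contained in \<open>P\<close>. Minimality would make it equal to
  \<open>P\<close>, although it misses \<open>x\<^sub>j\<close>.\<close>

lemma private_generator:
  assumes j: "j \<in> vars_of P"
  shows "\<exists>e\<in>E. Poly_Mapping.lookup e j = 1 \<and> (\<forall>i\<in>vars_of P - {j}. Poly_Mapping.lookup e i = 0)"
proof (rule ccontr)
  assume no: "\<not> ?thesis"
  let ?C = "vars_of P - {j}"
  have "\<exists>i\<in>?C. Poly_Mapping.lookup e i \<ge> 1" if e: "e \<in> E" for e
  proof (rule ccontr)
    assume *: "\<not> ?thesis"
    then have "\<forall>i\<in>?C. Poly_Mapping.lookup e i = 0" by (auto simp: Suc_le_eq)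
    moreover obtain i where "i \<in> vars_of P" "Poly_Mapping.lookup e i \<ge> 1"
      using I_sub_degree_ideal e unfolding I_subset_degree_ideal_iff[OF finite_vars_of] by blast
    moreover from this * have "i = j" by blast
    \<comment> \<open>A variable of \<open>C\<close> occurring in \<open>e\<close> must be the
      \<open>j\<close>-th; square-freeness turns exponent at least 1 into exactly 1.\<close>
    ultimately show False using no e E_squarefree[OF e, of j] by (metis le_antisym)
  qed
  then have "I \<subseteq> degree_ideal d ?C 1"
    using I_subset_degree_ideal_iff[of ?C] finite_vars_of by simp
  moreover have "degree_ideal d ?C 1 \<subseteq> P" by (rule degree_ideal_sub_P) blast
  moreover have "primeideal (degree_ideal d ?C 1) R" by (rule primeideal_degree_ideal)
  ultimately have "degree_ideal d ?C 1 = P"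
    using P unfolding minimal_primes_def by blast
  moreover have "variable j \<in> P" using j by (simp add: vars_of_def)
  ultimately have "variable j \<in> (degree_ideal d ?C 1 :: 'k mpoly set)" by simp
  then have "partial_degree ?C (Poly_Mapping.single j 1) \<ge> 1"
    by (simp add: degree_ideal_def keys_monomial)
  then show False by (simp add: partial_degree_def lookup_single when_def)
qed

text \<open>The product of the variables outside \<open>C\<close> becomes a unit after localization
  at \<open>P\<close>, so its powers can serve as denominators.\<close>

definition cofactor :: "nat \<Rightarrow>\<^sub>0 nat"
  where "cofactor = (\<Sum>i\<in>{..<d} - vars_of P. Poly_Mapping.single i 1)"

lemma lookup_cofactor: "Poly_Mapping.lookup cofactor i = (if i < d \<and> i \<notin> vars_of P then 1 else 0)"
  by (simp add: cofactor_def lookup_sum lookup_single when_def)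

lemma cofactor_exponents: "cofactor \<in> exponents d"
  by (simp add: exponents_iff lookup_cofactor)

lemma cofactor_notin_P: "monomial cofactor \<notin> P"
  using monomial_in_primeideal[OF P_prime cofactor_exponents]
  by (auto simp: lookup_cofactor vars_of_def split: if_splits)

text \<open>The private generator of \<open>x\<^sub>j\<close> is square-free and involves only
  \<open>x\<^sub>j\<close> and variables outside \<open>C\<close>, so it divides this
  monomial.\<close>

lemma cofactor_variable_in_I:
  assumes j: "j \<in> vars_of P"
  shows "monomial (cofactor + Poly_Mapping.single j 1) \<in> I"
proof -
  obtain e where e: "e \<in> E" "Poly_Mapping.lookup e j = 1" "\<forall>i\<in>vars_of P - {j}. Poly_Mapping.lookup e i = 0"
    using private_generator[OF j] by blast
  let ?u = "cofactor + Poly_Mapping.single j 1"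
  have ex: "e \<in> exponents d" "?u \<in> exponents d"
    using e(1) E_exponents cofactor_exponents j
    by (auto simp: exponents_add vars_of_def single_exponents)
  have le: "Poly_Mapping.lookup e i \<le> Poly_Mapping.lookup ?u i" for i
    using e ex E_squarefree[OF e(1), of i]
    by (cases "i < d") (auto simp: lookup_add lookup_cofactor lookup_single when_def exponents_iff)
  have u: "?u = e + (?u - e)"
    using le by (intro poly_mapping_eqI) (simp add: lookup_add[of e] lookup_minus)
  interpret I: ideal I R by (rule ideal_I)
  have "?u - e \<in> exponents d" using ex(2) by (subst (asm) u) (simp add: exponents_add)
  then have "monomial e \<otimes>\<^bsub>R\<^esub> monomial (?u - e) \<in> I"
    using e(1) generator_in_I by (intro I.I_r_closed) (simp_all add: keys_monomial)
  then show ?thesis by (subst u) (simp only: monomial_add mpoly_ring_simps)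
qed

lemma I_pow_sub_degree_ideal: "I [^]\<^bsub>ideals_set R\<^esub> (n::nat) \<subseteq> degree_ideal d (vars_of P) n"
proof (induction n)
  case 0
  then show ?case by (simp add: R.ideal_pow_simps degree_ideal_0)
next
  case (Suc n)
  show ?case
  proof
    fix f assume "f \<in> I [^]\<^bsub>ideals_set R\<^esub> Suc n"
    then have "f \<in> ideal_prod R (I [^]\<^bsub>ideals_set R\<^esub> n) I" unfolding R.ideal_pow_simps .
    then show "f \<in> degree_ideal d (vars_of P) (Suc n)"
    proof induction
      case (prod i j)
      then show ?case
        using degree_ideal_mult[of i d "vars_of P" n j 1] Suc I_sub_degree_ideal by auto
    qed (simp add: degree_ideal_add)
  qed
qed

text \<open>Each of the \<open>m\<close> cofactors is paired with a variable of \<open>C\<close>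
  split off from the term, and every such pair lies in \<open>I\<close>.\<close>

lemma cofactor_power_term:
  assumes "m \<le> partial_degree (vars_of P) e" "e \<in> exponents d"
  shows "monomial cofactor ^ m * Poly_Mapping.single e c \<in> I [^]\<^bsub>ideals_set R\<^esub> m"
  using assms
proof (induction m arbitrary: e)
  case 0
  then show ?case by (simp add: R.ideal_pow_simps)
next
  case (Suc m)
  then obtain j where j: "j \<in> vars_of P" "Poly_Mapping.lookup e j \<ge> 1"
    using partial_degree_pos_iff[OF finite_vars_of, of P e] by auto
  from j(2) obtain e' where e': "e = Poly_Mapping.single j 1 + e'" by (rule single_eq_add_single)
  have "partial_degree (vars_of P) (Poly_Mapping.single j 1) = 1"
    using j finite_vars_of by (simp add: partial_degree_def lookup_single when_def)
  then have "monomial cofactor ^ m * Poly_Mapping.single e' c \<in> I [^]\<^bsub>ideals_set R\<^esub> m"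
    using Suc.prems by (intro Suc.IH) (simp_all add: e' partial_degree_add exponents_add)
  then have "(monomial cofactor ^ m * Poly_Mapping.single e' c) \<otimes>\<^bsub>R\<^esub> monomial (cofactor + Poly_Mapping.single j 1)
      \<in> ideal_prod R (I [^]\<^bsub>ideals_set R\<^esub> m) I"
    using cofactor_variable_in_I[OF j(1)] by (rule ideal_prod.prod)
  moreover have "Poly_Mapping.single e c = variable j * Poly_Mapping.single e' c"
    by (simp add: monomial_def mult_single e')
  ultimately show ?case unfolding R.ideal_pow_simps(1) by (simp add: monomial_add mult_ac)
qed

text \<open>Together with \<open>I_pow_sub_degree_ideal\<close> this shows that \<open>I\<close> and
  the ideal of the variables in \<open>C\<close> have the same \<open>m\<close>-th power after
  localization at \<open>P\<close>.\<close>

lemma cofactor_power_degree_ideal: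
  assumes f: "f \<in> degree_ideal d (vars_of P) m"
  shows "monomial cofactor ^ m * f \<in> I [^]\<^bsub>ideals_set R\<^esub> m"
proof -
  interpret J: ideal "I [^]\<^bsub>ideals_set R\<^esub> m" R by (rule R.ideal_pow[OF ideal_I])
  have "monomial cofactor ^ m * Poly_Mapping.single e (Poly_Mapping.lookup f e) \<in> I [^]\<^bsub>ideals_set R\<^esub> m"
    if "e \<in> Poly_Mapping.keys f" for e
    using that f by (intro cofactor_power_term) (auto simp: degree_ideal_def)
  then show ?thesis
    by (rule poly_mapping_term_induct[where P = "\<lambda>g. monomial cofactor ^ m * g \<in> I [^]\<^bsub>ideals_set R\<^esub> m", rotated 1])
      (use J.zero_closed J.a_closed in \<open>auto simp: distrib_left\<close>)
qed

end

lemma frobenius_split_symbolic_power: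
  assumes p: "Factorial_Ring.prime CHAR('k)" "perfect_field TYPE('k)"
    and mn: "\<And>k. m \<le> CHAR('k) * k \<Longrightarrow> n \<le> k"
    and f: "f \<in> symbolic_power R I m"
  shows "frobenius_split f \<in> symbolic_power R I n"
  unfolding R.symbolic_power_iff[OF ideal_I]
proof (intro conjI ballI)
  \<comment> \<open>With \<open>C\<close> empty and both bounds 0, the degree lemma says just that
    the splitting preserves the polynomial ring.\<close>
  have "f \<in> degree_ideal d {} 0"
    using f by (simp add: R.symbolic_power_iff[OF ideal_I] degree_ideal_0)
  then have "frobenius_split f \<in> degree_ideal d {} 0"
    by (rule degree_ideal_frobenius_split[OF p, rotated]) simp
  then show "frobenius_split f \<in> carrier R" by (simp add: degree_ideal_0)
  fix P assume P: "P \<in> minimal_primes R I"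
  interpret P: multiplicative_set R "carrier R - P"
    using P by (intro R.multiplicative_set_compl) (simp add: minimal_primes_def)
  interpret J: ideal "I [^]\<^bsub>ideals_set R\<^esub> m" R by (rule R.ideal_pow[OF ideal_I])
  obtain s where s: "s \<in> carrier R - P" "s * f \<in> I [^]\<^bsub>ideals_set R\<^esub> m"
    using f P unfolding R.symbolic_power_iff[OF ideal_I] by auto
  have pow: "t ^ n \<in> carrier R - P" if "t \<in> carrier R - P" for t n
    using that by (induction n) (use P.S_one P.S_mult in auto)
  \<comment> \<open>The factor \<open>s ^ q\<close> with \<open>q = p - 1\<close> completes the
    denominator to a \<open>p\<close>-th power, which leaves the splitting as
    \<open>s\<close>.\<close>
  obtain q where q: "CHAR('k) = Suc q" using char_pos[OF p] gr0_implies_Suc by blast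
  have "s ^ q \<otimes>\<^bsub>R\<^esub> (s * f) \<in> I [^]\<^bsub>ideals_set R\<^esub> m"
    using pow[OF s(1), of q] s(2) by (intro J.I_l_closed) auto
  then have "s ^ CHAR('k) * f \<in> degree_ideal d (vars_of P) m"
    using I_pow_sub_degree_ideal[OF P, of m] by (auto simp: q mult_ac)
  then have "frobenius_split (s ^ CHAR('k) * f) \<in> degree_ideal d (vars_of P) n"
    by (intro degree_ideal_frobenius_split[OF p]) (rule mn)
  then have "s * frobenius_split f \<in> degree_ideal d (vars_of P) n"
    by (simp add: frobenius_split_power_mult[OF p])
  \<comment> \<open>The denominator for the image is this cofactor power times \<open>s\<close>;
    both factors lie outside \<open>P\<close>.\<close>
  then have "monomial (cofactor P) ^ n * (s * frobenius_split f) \<in> I [^]\<^bsub>ideals_set R\<^esub> n"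
    by (rule cofactor_power_degree_ideal[OF P])
  moreover have "monomial (cofactor P) \<in> carrier R - P"
    using cofactor_notin_P[OF P] cofactor_exponents[OF P] by (simp add: keys_monomial)
  then have "monomial (cofactor P) ^ n * s \<in> carrier R - P"
    using P.S_mult[OF pow s(1)] by simp
  ultimately show "\<exists>s\<in>carrier R - P. s \<otimes>\<^bsub>R\<^esub> frobenius_split f \<in> I [^]\<^bsub>ideals_set R\<^esub> n"
    by (intro bexI[of _ "monomial (cofactor P) ^ n * s"]) (simp_all add: mult.assoc)
qed

end

section \<open>Splitting the symbolic algebras\<close>

text \<open>Defined on the whole type \<open>poly\<close>, so that type-class arithmetic and
  freshman's dream apply; the conditions on the coefficients are imposed later.\<close>

definition poly_frobenius_split :: "'k::field mpoly poly \<Rightarrow> 'k mpoly poly"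
  where "poly_frobenius_split f =
    Abs_poly (\<lambda>n. frobenius_split (Polynomial.coeff f (CHAR('k) * n)))"

context
  assumes p: "Factorial_Ring.prime CHAR('k::field)" "perfect_field TYPE('k)"
begin

lemma coeff_poly_frobenius_split:
  "Polynomial.coeff (poly_frobenius_split f) n =
    frobenius_split (Polynomial.coeff (f :: 'k mpoly poly) (CHAR('k) * n))"
proof -
  have "frobenius_split (Polynomial.coeff f (CHAR('k) * i)) = 0" if "i > Polynomial.degree f" for i
  proof -
    \<comment> \<open>As \<open>p\<close> is positive, \<open>p * i\<close> exceeds the degree
      whenever \<open>i\<close> does; this finite support justifies \<open>Abs_poly\<close>.\<close>
    have "i \<le> CHAR('k) * i" using char_pos[OF p] by simp
    with that have "Polynomial.degree f < CHAR('k) * i" by linarith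
    then show ?thesis by (simp add: coeff_eq_0 frobenius_split_0[OF p])
  qed
  then show ?thesis
    unfolding poly_frobenius_split_def by (subst coeff_Abs_poly[where n = "Polynomial.degree f"]) auto
qed

lemma poly_frobenius_split_add:
  "poly_frobenius_split (f + g) = poly_frobenius_split f + poly_frobenius_split (g :: 'k mpoly poly)"
  by (intro poly_eqI) (simp add: coeff_poly_frobenius_split frobenius_split_add[OF p])

lemma poly_frobenius_split_1: "poly_frobenius_split (1 :: 'k mpoly poly) = 1"
  using char_pos[OF p]
  by (intro poly_eqI)
    (auto simp: coeff_poly_frobenius_split Polynomial.coeff_1 frobenius_split_1[OF p] frobenius_split_0[OF p])

lemma poly_frobenius_split_const_mult:
  "poly_frobenius_split ([:a:] ^ CHAR('k) * g) = [:a:] * poly_frobenius_split (g :: 'k mpoly poly)"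
  unfolding poly_const_pow
  by (intro poly_eqI) (simp add: coeff_poly_frobenius_split frobenius_split_power_mult[OF p])

lemma poly_frobenius_split_monom_mult:
  fixes g :: "'k mpoly poly"
  shows "poly_frobenius_split (Polynomial.monom 1 1 ^ CHAR('k) * g) =
    Polynomial.monom 1 1 * poly_frobenius_split g"
proof (intro poly_eqI)
  fix n
  show "Polynomial.coeff (poly_frobenius_split (Polynomial.monom 1 1 ^ CHAR('k) * g)) n =
      Polynomial.coeff (Polynomial.monom 1 1 * poly_frobenius_split g) n"
  proof (cases n)
    case 0
    then show ?thesis
      using char_pos[OF p]
      by (simp only: coeff_poly_frobenius_split monom_power coeff_monom_mult power_one mult_1
          mult_0_right if_True frobenius_split_0[OF p] zero_less_one)
  next
    case (Suc m)
    have "\<not> CHAR('k) * Suc m < 1 * CHAR('k)" "CHAR('k) * Suc m - 1 * CHAR('k) = CHAR('k) * m"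
      "\<not> Suc m < 1" "Suc m - 1 = m"
      by simp_all
    then show ?thesis
      unfolding Suc by (simp only: coeff_poly_frobenius_split monom_power coeff_monom_mult power_one
          if_False mult_1)
  qed
qed

text \<open>Induction along the Horner form \<open>a + t q\<close>: freshman's dream separates its
  \<open>p\<close>-th power, and the cases of a constant and of \<open>t\<close> combine with the
  induction hypothesis.\<close>

lemma poly_frobenius_split_power_mult:
  "poly_frobenius_split (f ^ CHAR('k) * g) = f * poly_frobenius_split (g :: 'k mpoly poly)"
proof (induction f arbitrary: g rule: pCons_induct)
  case 0
  have "(0 :: 'k mpoly poly) ^ CHAR('k) = 0" using char_pos[OF p] by (rule zero_power)
  then have "0 ^ CHAR('k) * g = 0" by (simp only: mult_zero_left)
  then show ?case
    by (simp only:) (intro poly_eqI, simp add: coeff_poly_frobenius_split frobenius_split_0[OF p])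
next
  case (pCons a q)
  let ?t = "Polynomial.monom 1 1 :: 'k mpoly poly"
  have "CHAR('k) = CHAR('k mpoly poly)" by (simp add: CHAR_poly_mapping)
  then have dream: "(u + v) ^ CHAR('k) = u ^ CHAR('k) + v ^ CHAR('k)" for u v :: "'k mpoly poly"
    using p(1) by (intro freshmans_dream) simp_all
  have pCons_eq: "pCons a q = [:a:] + ?t * q"
    by (intro poly_eqI) (simp add: coeff_pCons coeff_monom_mult split: nat.split)
  have "poly_frobenius_split (pCons a q ^ CHAR('k) * g) =
      poly_frobenius_split ([:a:] ^ CHAR('k) * g + ?t ^ CHAR('k) * (q ^ CHAR('k) * g))"
    unfolding pCons_eq dream by (simp only: power_mult_distrib distrib_right mult.assoc)
  also have "\<dots> = pCons a q * poly_frobenius_split g"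
    unfolding poly_frobenius_split_add poly_frobenius_split_const_mult
      poly_frobenius_split_monom_mult pCons.IH pCons_eq
    by (simp only: distrib_right mult.assoc)
  finally show ?case .
qed

end

lemma a_minus_mpoly_ring:
  fixes f g :: "'k::field mpoly"
  assumes "f \<in> carrier (mpoly_ring d)" "g \<in> carrier (mpoly_ring d)"
  shows "f \<ominus>\<^bsub>mpoly_ring d\<^esub> g = f - g"
proof -
  interpret cring "mpoly_ring d :: 'k mpoly ring" by (rule cring_mpoly_ring)
  have "\<ominus>\<^bsub>mpoly_ring d\<^esub> g = - g"
    by (rule minus_equality) (use assms mpoly_ring_closed(4)[of g d] in auto)
  then show ?thesis by (simp add: a_minus_def)
qed

lemma finsum_mpoly_ring:
  assumes "finite A" "\<And>i. i \<in> A \<Longrightarrow> f i \<in> carrier (mpoly_ring d :: 'k::field mpoly ring)"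
  shows "finsum (mpoly_ring d) f A = sum f A"
proof -
  interpret cring "mpoly_ring d :: 'k mpoly ring" by (rule cring_mpoly_ring)
  show ?thesis
    using assms
  proof (induction A rule: finite_induct)
    case (insert x A)
    then show ?case by (subst finsum_insert) (auto simp del: mpoly_ring_simps(1))
  qed simp
qed

lemma (in ideal) a_rcos_eq_self_iff:
  assumes "a \<in> carrier R"
  shows "I +> a = I \<longleftrightarrow> a \<in> I"
  using assms a_coset_join1 a_coset_join2 additive_subgroup.a_subgroup
  by (metis a_rcos_const a_rcos_self is_additive_subgroup)

section \<open>The symbolic algebras as images of a set of polynomials\<close>

context squarefree_ideal
begin

abbreviation "sp \<equiv> symbolic_power R I"

lemma sp_ideal: "ideal (sp n) R"
  by (rule R.ideal_symbolic_power[OF ideal_I])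

lemma sp_carrier: "f \<in> sp n \<Longrightarrow> f \<in> carrier R"
  using ideal.Icarr[OF sp_ideal] .

lemma sp_0: "sp 0 = carrier R"
  by (simp add: symbolic_power_def)

lemma sp_zero: "0 \<in> sp n"
  using additive_subgroup.zero_closed[OF ideal.axioms(1)[OF sp_ideal]] by simp

lemma sp_add: "f \<in> sp n \<Longrightarrow> g \<in> sp n \<Longrightarrow> f + g \<in> sp n"
  using additive_subgroup.a_closed[OF ideal.axioms(1)[OF sp_ideal], of f n g] by simp

lemma sp_mult: "f \<in> sp m \<Longrightarrow> g \<in> sp n \<Longrightarrow> f * g \<in> sp (m + n)"
  using R.symbolic_power_mult[OF ideal_I, of f m g n] by simp

lemma sp_uminus: "f \<in> sp n \<Longrightarrow> - f \<in> sp n"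
  using sp_mult[of "- 1" 0 f n] mpoly_ring_closed(4)[OF mpoly_ring_closed(1)] by (simp add: sp_0)

lemma sp_sum: "(\<And>i. i \<in> A \<Longrightarrow> f i \<in> sp n) \<Longrightarrow> sum f A \<in> sp n"
  by (induction A rule: infinite_finite_induct) (simp_all add: sp_zero sp_add)

text \<open>The symbolic Rees algebra inside the type \<open>poly\<close>;
  \<open>Polynomial.coeff\<close> carries it onto the record version, whose elements are coefficient
  functions.\<close>

definition rees :: "'k mpoly poly set"
  where "rees = {f. \<forall>n. Polynomial.coeff f n \<in> sp n}"

lemma rees_one: "1 \<in> rees"
  unfolding rees_def mem_Collect_eq
proof
  fix n
  have "1 \<in> sp 0" unfolding sp_0 by (rule mpoly_ring_closed(1))
  then show "Polynomial.coeff 1 n \<in> sp n"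
    by (cases n) (simp_all add: Polynomial.coeff_1 sp_zero)
qed

lemma rees_add: "f \<in> rees \<Longrightarrow> g \<in> rees \<Longrightarrow> f + g \<in> rees"
  by (simp add: rees_def sp_add)

lemma rees_uminus: "f \<in> rees \<Longrightarrow> - f \<in> rees"
  by (simp add: rees_def sp_uminus)

lemma rees_mult:
  assumes "f \<in> rees" "g \<in> rees"
  shows "f * g \<in> rees"
  unfolding rees_def mem_Collect_eq coeff_mult
proof (intro allI sp_sum)
  fix n i :: nat assume "i \<in> {..n}"
  then have "i + (n - i) = n" by simp
  moreover have "Polynomial.coeff f i * Polynomial.coeff g (n - i) \<in> sp (i + (n - i))"
    using assms unfolding rees_def by (intro sp_mult) blast+
  ultimately show "Polynomial.coeff f i * Polynomial.coeff g (n - i) \<in> sp n" by (simp only:)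
qed

lemmas rees_closed = rees_one rees_add rees_mult rees_uminus

lemma coeff_rees: "f \<in> rees \<Longrightarrow> Polynomial.coeff f n \<in> sp n"
  and coeff_rees_carrier: "f \<in> rees \<Longrightarrow> Polynomial.coeff f n \<in> carrier R"
  using sp_carrier by (auto simp: rees_def)

lemma coeff_rees_up: "f \<in> rees \<Longrightarrow> Polynomial.coeff f \<in> up R"
  using coeff_rees_carrier coeff_eq_0 unfolding up_def bound_def by fastforce

lemma finsum_coeff_rees:
  assumes "f \<in> rees" "g \<in> rees"
  shows "finsum R (\<lambda>i. Polynomial.coeff f i * Polynomial.coeff g (n - i)) {..n} =
    Polynomial.coeff (f * g) n"
  unfolding coeff_mult
  using assms by (intro finsum_mpoly_ring mpoly_ring_closed coeff_rees_carrier) auto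

lemma rees_of_family:
  assumes "\<And>n. a n \<in> sp n" "finite {n. a n \<noteq> 0}"
  obtains f where "f \<in> rees" "Polynomial.coeff f = a"
proof
  have *: "Polynomial.coeff (Abs_poly a) = a"
    using assms(2) by (intro Abs_poly_inverse) (simp add: MOST_iff_cofinite eventually_cofinite)
  then show "Polynomial.coeff (Abs_poly a) = a" .
  show "Abs_poly a \<in> rees" using assms(1) by (simp add: rees_def *)
qed

lemma coeff_image_rees: "Polynomial.coeff ` rees = carrier (symbolic_Rees_algebra R I)"
proof (intro equalityI subsetI)
  fix a assume "a \<in> Polynomial.coeff ` rees"
  then show "a \<in> carrier (symbolic_Rees_algebra R I)"
    using coeff_rees_up coeff_rees by (auto simp: symbolic_Rees_algebra_def UP_def)
next
  fix a assume "a \<in> carrier (symbolic_Rees_algebra R I)"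
  then have a: "a \<in> up R" "\<And>n. a n \<in> sp n"
    by (auto simp: symbolic_Rees_algebra_def UP_def)
  from a(1) obtain m where "bound 0 m a" by (auto simp: up_def)
  then have "{n. a n \<noteq> 0} \<subseteq> {..m}" by (auto simp: bound_def not_less[symmetric])
  then have "finite {n. a n \<noteq> 0}" using finite_subset by blast
  with a(2) obtain f where "f \<in> rees" "Polynomial.coeff f = a" by (rule rees_of_family)
  then show "a \<in> Polynomial.coeff ` rees" by blast
qed

text \<open>The quotient map from the symbolic Rees algebra onto the associated graded
  algebra.\<close>

definition gr_class :: "'k mpoly poly \<Rightarrow> nat \<Rightarrow> 'k mpoly set"
  where "gr_class f n = sp (Suc n) +>\<^bsub>R\<^esub> Polynomial.coeff f n"

lemma coset_eq_iff:
  assumes "f \<in> carrier R" "g \<in> carrier R"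
  shows "sp n +>\<^bsub>R\<^esub> f = sp n +>\<^bsub>R\<^esub> g \<longleftrightarrow> f - g \<in> sp n"
  unfolding R.quotient_eq_iff_same_a_r_cos[OF sp_ideal assms, symmetric] a_minus_mpoly_ring[OF assms] ..

lemma coset_eq_self_iff: "f \<in> carrier R \<Longrightarrow> sp n +>\<^bsub>R\<^esub> f = sp n \<longleftrightarrow> f \<in> sp n"
  by (rule ideal.a_rcos_eq_self_iff[OF sp_ideal])

lemma mem_coset_iff:
  "g \<in> sp n +>\<^bsub>R\<^esub> f \<longleftrightarrow> g - f \<in> sp n"
proof
  assume "g \<in> sp n +>\<^bsub>R\<^esub> f"
  then obtain h where "h \<in> sp n" "g = h + f" unfolding a_r_coset_def' by auto
  then show "g - f \<in> sp n" by simp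
next
  assume "g - f \<in> sp n"
  then have "\<exists>h\<in>sp n. g = h + f" by (rule bexI[rotated]) simp
  then show "g \<in> sp n +>\<^bsub>R\<^esub> f" unfolding a_r_coset_def' by simp
qed

text \<open>The cosets belong to different ideals, so independence of representatives rests on
  \<open>a b - f g = (a - f) b + f (b - g)\<close>, where each difference lies one step deeper in
  the filtration.\<close>

lemma rcoset_mult_coset:
  assumes f: "f \<in> sp m" and g: "g \<in> sp n"
  shows "rcoset_mult R (sp (Suc (m + n))) (sp (Suc m) +>\<^bsub>R\<^esub> f) (sp (Suc n) +>\<^bsub>R\<^esub> g) =
    sp (Suc (m + n)) +>\<^bsub>R\<^esub> (f * g)"
proof -
  have car: "f \<in> carrier R" "g \<in> carrier R" using f g sp_carrier by blast+
  have "sp (Suc (m + n)) +>\<^bsub>R\<^esub> (a * b) = sp (Suc (m + n)) +>\<^bsub>R\<^esub> (f * g)"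
    if a: "a \<in> sp (Suc m) +>\<^bsub>R\<^esub> f" and b: "b \<in> sp (Suc n) +>\<^bsub>R\<^esub> g" for a b
  proof (subst coset_eq_iff)
    have af: "a - f \<in> sp (Suc m)" "b - g \<in> sp (Suc n)" using a b by (simp_all only: mem_coset_iff)
    have ab: "a \<in> carrier R" "b \<in> carrier R"
      using mpoly_ring_closed(2)[OF sp_carrier[OF af(1)] car(1)] mpoly_ring_closed(2)[OF sp_carrier[OF af(2)] car(2)]
      by simp_all
    show "a * b \<in> carrier R" using ab by (rule mpoly_ring_closed(3))
    show "f * g \<in> carrier R" using car by (rule mpoly_ring_closed(3))
    \<comment> \<open>For \<open>b\<close> the exponent \<open>n\<close> is enough, because
      \<open>a - f\<close> supplies the extra one.\<close>
    have "b - g + g \<in> sp n"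
      using af(2) g R.symbolic_power_Suc_subset[OF ideal_I, of n] by (intro sp_add) blast+
    then have "(a - f) * b \<in> sp (Suc m + n)" "f * (b - g) \<in> sp (m + Suc n)"
      using af f by (simp_all only: diff_add_cancel sp_mult)
    then have "(a - f) * b + f * (b - g) \<in> sp (Suc (m + n))" by (intro sp_add) simp_all
    then show "a * b - f * g \<in> sp (Suc (m + n))" by (simp add: algebra_simps)
  qed
  note eq = this
  have fg: "f \<in> sp (Suc m) +>\<^bsub>R\<^esub> f" "g \<in> sp (Suc n) +>\<^bsub>R\<^esub> g"
    by (simp_all only: mem_coset_iff diff_self sp_zero)
  have "rcoset_mult R (sp (Suc (m + n))) (sp (Suc m) +>\<^bsub>R\<^esub> f) (sp (Suc n) +>\<^bsub>R\<^esub> g) =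
      (\<Union>a\<in>sp (Suc m) +>\<^bsub>R\<^esub> f. \<Union>b\<in>sp (Suc n) +>\<^bsub>R\<^esub> g. sp (Suc (m + n)) +>\<^bsub>R\<^esub> (f * g))"
    unfolding rcoset_mult_def mpoly_ring_simps by (intro SUP_cong refl eq)
  also have "\<dots> = sp (Suc (m + n)) +>\<^bsub>R\<^esub> (f * g)"
    using fg by blast
  finally show ?thesis .
qed

lemma gr_class_add:
  assumes "f \<in> rees" "g \<in> rees"
  shows "gr_class (f + g) = gr_class f \<oplus>\<^bsub>symbolic_gr R I\<^esub> gr_class g"
proof
  fix n
  interpret ideal "sp (Suc n)" R by (rule sp_ideal)
  interpret Q: ring_hom_cring R "R Quot sp (Suc n)" "(+>\<^bsub>R\<^esub>) (sp (Suc n))"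
    by (rule rcos_ring_hom_cring[OF R.is_cring])
  show "gr_class (f + g) n = (gr_class f \<oplus>\<^bsub>symbolic_gr R I\<^esub> gr_class g) n"
    using Q.hom_add[OF coeff_rees_carrier[OF assms(1)] coeff_rees_carrier[OF assms(2)]]
    unfolding gr_class_def symbolic_gr_def by (simp only: ring_record_simps coeff_add mpoly_ring_simps)
qed

text \<open>The coset map modulo \<open>sp (Suc n)\<close> is a ring homomorphism, so it commutes
  with the convolution sum, whose terms are computed by \<open>rcoset_mult_coset\<close>.\<close>

lemma gr_class_mult:
  assumes "f \<in> rees" "g \<in> rees"
  shows "gr_class (f * g) = gr_class f \<otimes>\<^bsub>symbolic_gr R I\<^esub> gr_class g"
proof
  fix n
  interpret ideal "sp (Suc n)" R by (rule sp_ideal)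
  let ?Q = "R Quot sp (Suc n)"
  interpret Q: ring_hom_cring R ?Q "(+>\<^bsub>R\<^esub>) (sp (Suc n))"
    by (rule rcos_ring_hom_cring[OF R.is_cring])
  let ?c = "\<lambda>i. Polynomial.coeff f i * Polynomial.coeff g (n - i)"
  have car: "?c i \<in> carrier R" for i
    using assms coeff_rees_carrier by (intro mpoly_ring_closed) auto
  have "(gr_class f \<otimes>\<^bsub>symbolic_gr R I\<^esub> gr_class g) n =
      finsum ?Q (\<lambda>i. rcoset_mult R (sp (Suc n)) (gr_class f i) (gr_class g (n - i))) {..n}"
    by (simp add: symbolic_gr_def)
  also have "\<dots> = finsum ?Q ((+>\<^bsub>R\<^esub>) (sp (Suc n)) \<circ> ?c) {..n}"
  proof (rule Q.S.finsum_cong')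
    fix i assume "i \<in> {..n}"
    then show "rcoset_mult R (sp (Suc n)) (gr_class f i) (gr_class g (n - i)) =
        ((+>\<^bsub>R\<^esub>) (sp (Suc n)) \<circ> ?c) i"
      using rcoset_mult_coset[of "Polynomial.coeff f i" i "Polynomial.coeff g (n - i)" "n - i"] assms
      by (simp add: gr_class_def coeff_rees)
  qed (use car in auto)
  also have "\<dots> = sp (Suc n) +>\<^bsub>R\<^esub> finsum R ?c {..n}"
    using car by (subst Q.hom_finsum) auto
  finally show "gr_class (f * g) n = (gr_class f \<otimes>\<^bsub>symbolic_gr R I\<^esub> gr_class g) n"
    by (simp add: gr_class_def finsum_coeff_rees[OF assms])
qed

lemma carrier_symbolic_gr_iff:
  "a \<in> carrier (symbolic_gr R I) \<longleftrightarrow>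
    (\<forall>n. \<exists>b\<in>sp n. a n = sp (Suc n) +>\<^bsub>R\<^esub> b) \<and> finite {n. a n \<noteq> sp (Suc n)}"
  unfolding symbolic_gr_def partial_object.select_convs mem_Collect_eq image_iff ..

lemma coset_zero: "sp n +>\<^bsub>R\<^esub> 0 = sp n"
  using coset_eq_self_iff[OF sp_carrier[OF sp_zero[of n]], of n] sp_zero[of n] by blast

lemma gr_class_image: "gr_class ` rees = carrier (symbolic_gr R I)"
proof (intro equalityI subsetI)
  fix a assume "a \<in> gr_class ` rees"
  then obtain f where f: "f \<in> rees" "a = gr_class f" by blast
  have "n \<le> Polynomial.degree f" if "a n \<noteq> sp (Suc n)" for n
  proof (rule ccontr)
    assume "\<not> n \<le> Polynomial.degree f"
    then have "Polynomial.coeff f n = 0" by (simp add: coeff_eq_0)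
    with that show False unfolding f(2) gr_class_def by (simp only: coset_zero)
  qed
  then have "finite {n. a n \<noteq> sp (Suc n)}" by (auto intro: finite_subset[OF _ finite_atMost[of "Polynomial.degree f"]])
  moreover have "\<forall>n. \<exists>b\<in>sp n. a n = sp (Suc n) +>\<^bsub>R\<^esub> b"
    using coeff_rees[OF f(1)] unfolding f(2) gr_class_def by blast
  ultimately show "a \<in> carrier (symbolic_gr R I)" unfolding carrier_symbolic_gr_iff by blast
next
  fix a assume "a \<in> carrier (symbolic_gr R I)"
  then have "\<forall>n. \<exists>b. b \<in> sp n \<and> a n = sp (Suc n) +>\<^bsub>R\<^esub> b"
    and fin: "finite {n. a n \<noteq> sp (Suc n)}"
    unfolding carrier_symbolic_gr_iff by blast+
  from choice[OF this(1)] obtain b where b: "\<And>n. b n \<in> sp n" "\<And>n. a n = sp (Suc n) +>\<^bsub>R\<^esub> b n"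
    by blast
  \<comment> \<open>Chosen representatives of zero cosets may be nonzero; resetting them to 0 makes
    the family finitely supported.\<close>
  define c where "c n = (if a n = sp (Suc n) then 0 else b n)" for n
  have "finite {n. c n \<noteq> 0}" using fin by (rule rev_finite_subset) (auto simp only: c_def split: if_splits)
  moreover have "c n \<in> sp n" for n unfolding c_def using b(1)[of n] sp_zero[of n] by (simp split: if_split)
  ultimately obtain f where f: "f \<in> rees" "Polynomial.coeff f = c" using rees_of_family[of c] by blast
  have "gr_class f = a"
  proof
    show "gr_class f n = a n" for n
      unfolding gr_class_def f(2) c_def using b(2)[of n] coset_zero[of "Suc n"]
      by (simp split: if_split)
  qed
  then show "a \<in> gr_class ` rees" using f(1) by blast
qed

lemma gr_class_eq_zero_iff:
  assumes "f \<in> rees"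
  shows "gr_class f = \<zero>\<^bsub>symbolic_gr R I\<^esub> \<longleftrightarrow> (\<forall>n. Polynomial.coeff f n \<in> sp (Suc n))"
proof -
  have "\<zero>\<^bsub>symbolic_gr R I\<^esub> n = sp (Suc n)" for n
    unfolding symbolic_gr_def by (simp only: ring_record_simps)
  moreover have "gr_class f n = sp (Suc n) \<longleftrightarrow> Polynomial.coeff f n \<in> sp (Suc n)" for n
    unfolding gr_class_def by (rule coset_eq_self_iff[OF coeff_rees_carrier[OF assms]])
  ultimately show ?thesis
    using fun_eq_iff[of "gr_class f" "\<zero>\<^bsub>symbolic_gr R I\<^esub>"] by (simp only:)
qed

context
  assumes p: "Factorial_Ring.prime CHAR('k)" "perfect_field TYPE('k)"
begin

lemma poly_frobenius_split_rees:
  assumes "f \<in> rees"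
  shows "poly_frobenius_split f \<in> rees"
  unfolding rees_def mem_Collect_eq coeff_poly_frobenius_split[OF p]
proof
  fix n
  have "n \<le> k" if "CHAR('k) * n \<le> CHAR('k) * k" for k
    using that char_pos[OF p] by (simp only: mult_le_cancel1)
  then show "frobenius_split (Polynomial.coeff f (CHAR('k) * n)) \<in> sp n"
    by (rule frobenius_split_symbolic_power[OF p _ coeff_rees[OF assms]])
qed

text \<open>A coefficient of degree \<open>p n\<close> with zero class lies in the symbolic power of
  exponent \<open>p n + 1\<close>, and \<open>p n + 1 \<le> p k\<close> forces
  \<open>n + 1 \<le> k\<close>.\<close>

lemma poly_frobenius_split_kernel:
  assumes "f \<in> rees" "gr_class f = \<zero>\<^bsub>symbolic_gr R I\<^esub>"
  shows "gr_class (poly_frobenius_split f) = \<zero>\<^bsub>symbolic_gr R I\<^esub>"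
  unfolding gr_class_eq_zero_iff[OF poly_frobenius_split_rees[OF assms(1)]]
    coeff_poly_frobenius_split[OF p]
proof
  fix n
  have f: "Polynomial.coeff f (CHAR('k) * n) \<in> sp (Suc (CHAR('k) * n))"
    using assms(2) unfolding gr_class_eq_zero_iff[OF assms(1)] by blast
  have "Suc n \<le> k" if "Suc (CHAR('k) * n) \<le> CHAR('k) * k" for k
    using that by (simp only: Suc_le_eq mult_less_cancel1)
  then show "frobenius_split (Polynomial.coeff f (CHAR('k) * n)) \<in> sp (Suc n)"
    by (rule frobenius_split_symbolic_power[OF p _ f])
qed

lemma F_pure_symbolic_Rees_algebra:
  "F_pure TYPE('m) CHAR('k) (symbolic_Rees_algebra R I)"
proof (rule F_pure_of_splitting[where B = rees and h = Polynomial.coeff and \<psi> = poly_frobenius_split])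
  show "CHAR('k mpoly poly) = CHAR('k)" by (simp add: CHAR_poly_mapping)
  show "Polynomial.coeff ` rees = carrier (symbolic_Rees_algebra R I)" by (rule coeff_image_rees)
  fix f g assume fg: "f \<in> rees" "g \<in> rees"
  show "Polynomial.coeff (f + g) = Polynomial.coeff f \<oplus>\<^bsub>symbolic_Rees_algebra R I\<^esub> Polynomial.coeff g"
    using fg by (simp add: symbolic_Rees_algebra_def UP_def coeff_rees_up fun_eq_iff)
  show "Polynomial.coeff (f * g) = Polynomial.coeff f \<otimes>\<^bsub>symbolic_Rees_algebra R I\<^esub> Polynomial.coeff g"
    using fg by (simp add: symbolic_Rees_algebra_def UP_def coeff_rees_up finsum_coeff_rees fun_eq_iff)
next
  fix f assume "Polynomial.coeff f = \<zero>\<^bsub>symbolic_Rees_algebra R I\<^esub>"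
  then show "Polynomial.coeff (poly_frobenius_split f) = \<zero>\<^bsub>symbolic_Rees_algebra R I\<^esub>"
    by (simp add: symbolic_Rees_algebra_def UP_def fun_eq_iff coeff_poly_frobenius_split[OF p]
        frobenius_split_0[OF p])
qed (simp_all add: p rees_closed poly_frobenius_split_rees poly_frobenius_split_add[OF p]
    poly_frobenius_split_power_mult[OF p] poly_frobenius_split_1[OF p]
    symbolic_Rees_algebra_def UP_def Polynomial.coeff_1 fun_eq_iff)

lemma F_pure_symbolic_gr:
  "F_pure TYPE('m) CHAR('k) (symbolic_gr R I)"
proof (rule F_pure_of_splitting[where B = rees and h = gr_class and \<psi> = poly_frobenius_split])
  show "CHAR('k mpoly poly) = CHAR('k)" by (simp add: CHAR_poly_mapping)
  show "gr_class 1 = \<one>\<^bsub>symbolic_gr R I\<^esub>"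
    using coset_eq_self_iff[of 0] sp_zero
    by (auto simp: gr_class_def symbolic_gr_def fun_eq_iff Polynomial.coeff_1)
  show "gr_class 0 = \<zero>\<^bsub>symbolic_gr R I\<^esub>"
    using coset_eq_self_iff[of 0] sp_zero
    by (auto simp: gr_class_def symbolic_gr_def fun_eq_iff)
qed (simp_all add: p rees_closed poly_frobenius_split_rees poly_frobenius_split_add[OF p]
    poly_frobenius_split_power_mult[OF p] poly_frobenius_split_1[OF p]
    gr_class_add gr_class_mult gr_class_image poly_frobenius_split_kernel)

end

end

theorem corollary4p4:
  fixes p d :: nat and I :: "((nat \<Rightarrow>\<^sub>0 nat) \<Rightarrow>\<^sub>0 'k::field) set"
  assumes "Factorial_Ring.prime p" and "CHAR('k) = p" and "perfect_field TYPE('k)"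
    and "squarefree_monomial_ideal d I"
  shows "F_pure TYPE('m) p (symbolic_Rees_algebra (mpoly_ring d) I) \<and>
         F_pure TYPE('m) p (symbolic_gr (mpoly_ring d) I)"
proof -
  obtain E where "E \<subseteq> exponents d" "\<forall>e\<in>E. \<forall>i. Poly_Mapping.lookup e i \<le> 1"
    "I = genideal (mpoly_ring d) (monomial ` E)"
    using assms(4) unfolding squarefree_monomial_ideal_def by blast
  then interpret squarefree_ideal d E I by unfold_locales auto
  show ?thesis
    using F_pure_symbolic_Rees_algebra F_pure_symbolic_gr assms(1-3) by simp
qed

end
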